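(* Let $V$ and $W$ be simple objects of $\mathcal{O}^+_q$, and let $$R'(u):(\mathcal{F}_{q^{-1}}(W))(u)\otimes\mathcal{F}_{q^{-1}}(V)\to\mathcal{F}_{q^{-1}}(V)\otimes(\mathcal{F}_{q^{-1}}(W))(u)$$ be the affine $R$-matrix of $\mathcal{O}_{q^{-1}}^-$ attached to the simple objects $\mathcal{F}_{q^{-1}}(W)$ and $\mathcal{F}_{q^{-1}}(V)$ of $\mathcal{O}^-_{q^{-1}}$. Then $R(u)=\tau\circ R'(u^{-1})\circ\tau$, where $\tau$ denotes the flip of tensor factors, produces a $U_{q,u}(\mathfrak{b})$-linear isomorphism from $V(u)\otimes W$ to $W\otimes V(u)$.
   Context: Algebras. Let $q=e^{h}\in\mathbb{C}^{\times}$ ($h\in\mathbb{C}$) be not a root of unity and $q^r:=e^{hr}$. Everything is over $\mathbb{C}$ (over $\mathbb{C}(u)$ when the formal variable $u$ is present); $\mathbb{N}=\mathbb{Z}_{\ge 0}$. Let $C=(C_{i,j})_{0\le i,j\le n}$ be an indecomposable Cartan matrix of untwisted affine type, with affine Kac--Moody algebra $\mathfrak{g}$; $d_0,\dots,d_n$ relatively prime positive integers with $(d_iC_{i,j})$ symmetric; $a_0=1,a_1,\dots,a_n\in\mathbb{N}$ relatively prime with $C(a_0,\dots,a_n)^T=0$; $q_i=q^{d_i}$; $I=\{1,\dots,n\}$; $[m]_x=\frac{x^m-x^{-m}}{x-x^{-1}}$, $[m]_x!=\prod_{r=1}^m[r]_x$. The quantum loop algebra $U_q(\mathfrak{g})$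 is generated by $\{e_i,f_i,k_i^{\pm1}\}_{i=0}^n$ with relations $k_ik_j=k_jk_i$, $k_i^{\pm1}k_i^{\mp1}=1=k_0^{a_0}\cdots k_n^{a_n}$, $k_ie_jk_i^{-1}=q_i^{C_{i,j}}e_j$, $k_if_jk_i^{-1}=q_i^{-C_{i,j}}f_j$, $[e_i,f_j]=\delta_{i,j}\frac{k_i-k_i^{-1}}{q_i-q_i^{-1}}$ and, for $i\ne j$, $\sum_{r=0}^{1-C_{i,j}}(-1)^r x_i^{(1-C_{i,j}-r)}x_jx_i^{(r)}=0$ for $x=e$ and for $x=f$, where $x_i^{(r)}=x_i^r/[r]_{q_i}!$. Coproduct: $\Delta(e_i)=e_i\otimes1+k_i\otimes e_i$, $\Delta(f_i)=f_i\otimes k_i^{-1}+1\otimes f_i$, $\Delta(k_i)=k_i\otimes k_i$. The Borel subalgebra $U_q(\mathfrak{b})$ is the (Hopf) subalgebra generated by $\{e_i,k_i^{\pm1}\}_{i=0}^n$. $U_{q^{-1}}(\mathfrak{g})$, $U_{q^{-1}}(\mathfrak{b})$ are the same with $q$ replaced by $q^{-1}$. Drinfeld generators. $U_q(\mathfrak{g})$ is also generated by $\{x_{i,r}^\pm,\phi_{i,r}^\pm: i\in I,r\in\mathbb{Z}\}$, with $\phi_{i,0}^\pm=k_i^{\pm1}$, $\phi^\pm_{i,\pm m}=0$ for $m<0$, and Drinfeld's relations: the $\phi$'s commute; $k_ix_{j,r}^\pm k_i^{-1}=q_i^{\pm C_{i,j}}x_{j,r}^\pm$; $[h_{i,m},x_{j,r}^\pm]=\pm\frac1m[mC_{i,j}]_{q_i}x^\pm_{j,r+m}$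 ($m\neq0$), where $\sum_{m\ge0}\phi_{i,\pm m}^\pm z^{\pm m}=k_i^{\pm1}\exp(\pm(q_i-q_i^{-1})\sum_{m>0}h_{i,\pm m}z^{\pm m})$; $[x_{i,r}^+,x_{j,s}^-]=\delta_{i,j}\frac{\phi^+_{i,r+s}-\phi^-_{i,r+s}}{q_i-q_i^{-1}}$; $x_{i,r+1}^\pm x_{j,s}^\pm-q_i^{\pm C_{i,j}}x_{j,s}^\pm x_{i,r+1}^\pm=q_i^{\pm C_{i,j}}x_{i,r}^\pm x_{j,s+1}^\pm-x_{j,s+1}^\pm x_{i,r}^\pm$; and the usual Drinfeld--Serre relations. A correspondence between the two presentations is fixed (for $q$ and for $q^{-1}$), with $e_i=x_{i,0}^+$, $f_i=x_{i,0}^-$ for $i\in I$ and with $x_{i,r}^\pm,\phi_{i,r}^\pm$ of degree $r$ for the $\mathbb{Z}$-grading $\deg e_0=-\deg f_0=1$, $\deg e_i=\deg f_i=\deg k_i^{\pm 1}=0$ ($i\in I$). Spectral parameter. $U_{q,u}(\mathfrak{g})=U_q(\mathfrak{g})\otimes\mathbb{C}(u)$, $U_{q,u}(\mathfrak{b})=U_q(\mathfrak{b})\otimes\mathbb{C}(u)$; $\tau_u$ is the $\mathbb{C}(u)$-algebra automorphism with $\tau_u(x)=u^mx$ for $x$ of degree $m$, and $V(u)$ is the pullback of $V\otimes\mathbb{C}(u)$ by $\tau_u$ (similarly $V(u^{-1})$). Category $\mathcal{O}$. Let $\mathfrak{t}^\times=(\mathbb{C}^\times)^I$. For a $U_q(\mathfrak{b})$-module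 $V$ and $\mu\in\mathfrak{t}^\times$ put $V_\mu=\{v\in V: k_iv=\mu_iv\ \forall i\in I\}$, $P(V)=\{\mu:V_\mu\neq0\}$. Let $\alpha_i,\omega_i$ ($i\in I$) be the simple roots and fundamental weights of the simple Lie algebra with Cartan matrix $(C_{i,j})_{i,j\in I}$ ($\alpha_i=\sum_jC_{j,i}\omega_j$), $Q^+=\bigoplus\mathbb{N}\alpha_i$, $P_{\mathbb{Q}}=\bigoplus\mathbb{Q}\omega_i$, and $\omega\mapsto\overline{\omega}$ the injective group morphism $P_{\mathbb{Q}}\to\mathfrak{t}^\times$ with $\overline{\omega_i}=(q_i^{\delta_{ij}})_{j\in I}$. Write $\mu\le\nu$ iff $\nu\mu^{-1}\in\overline{Q^+}$ and $D(\lambda)=\{\mu:\mu\le\lambda\}$. $\mathcal{O}_q$ is the full monoidal subcategory of $U_q(\mathfrak{b})$-modules $V$ with $V=\bigoplus_\mu V_\mu$, $\dim V_\mu<\infty$, $P(V)\subseteq\bigcup_{i=1}^sD(\lambda_i)$ for some $\lambda_1,\dots,\lambda_s$. $\mathcal{O}_{q^{-1}}$ is the analogue with $q$ replaced by $q^{-1}$ everywhere. Simple objects. $\mathfrak{r}$ is the group of families $\Psi=(\Psi_i(z))_{i\in I}$, $\Psi_i(z)=\sum_{r\ge0}\Psi_{i,r}z^r$, of rational functions regular and nonzero at $z=0$; $\mathfrak{t}^\times\subseteq\mathfrak{r}$ as constants. $L_q(\Psi)$ is the unique simple $U_q(\mathfrak{b})$-module generated by a (highest $\ell$-weight) vector $v\ne0$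 with $e_iv=0$, $\phi_{i,r}^+v=\Psi_{i,r}v$; these are all simple objects of $\mathcal{O}_q$. $\Psi_{i,a}$ has $i$-th component $1-az$ and others $1$; $Y_{i,a}^{(q)}=\overline{\omega_i}\Psi_{i,aq_i^{-1}}\Psi_{i,aq_i}^{-1}$ ($a\in\mathbb{C}^\times$). $\mathcal{O}_q^+$ (resp. $\mathcal{O}_q^-$) is the full subcategory of objects whose simple constituents have as highest $\ell$-weight a monomial in the $Y_{i,a}^{(q)}$, the $\Psi_{i,a}$ (resp. $\Psi_{i,a}^{-1}$) and the $\mu\in\mathfrak{t}^\times$. Same notation for $q^{-1}$. Functors. $\sigma_q:U_q(\mathfrak{g})\to U_{q^{-1}}(\mathfrak{g})$ is the algebra isomorphism with $\sigma_q(e_i)=-k_i^{-1}e_i$, $\sigma_q(f_i)=-f_ik_i$, $\sigma_q(k_i)=k_i^{-1}$ ($0\le i\le n$); it restricts to Borel subalgebras, and $\mathcal{F}_q:\mathcal{O}_{q^{-1}}\to\mathcal{O}_q$ is pullback along it, with inverse $\mathcal{F}_{q^{-1}}$ (pullback along $\sigma_{q^{-1}}=\sigma_q^{-1}$); $\mathcal{F}_{q^{-1}}$ maps $\mathcal{O}_q^+$ to $\mathcal{O}_{q^{-1}}^-$. Affine $R$-matrices of $\mathcal{O}^-$ (stated for $q$; replace $q$ by $q^{-1}$ for $\mathcal{O}^-_{q^{-1}}$). For simple finite-dimensional $U_q(\mathfrak{g})$-modules $A,B$ (of the form $L_q(\Psi)$, $\Psi$ a monomial in the $Y_{i,a}^{(q)}$)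 the rational $R$-matrix $R_{A,B}(u)$ is the unique $U_{q,u}(\mathfrak{g})$-linear isomorphism $A(u)\otimes B\to B\otimes A(u)$ with $v\otimes w\mapsto w\otimes v$ on highest $\ell$-weight vectors. Let $V,W$ be simple in $\mathcal{O}_q^-$. By known results there are simple finite-dimensional $U_q(\mathfrak{g})$-modules $V_k=L_q(\Psi_k)$, $W_k=L_q(\Psi_k')$ ($k\ge1$) whose normalized $q$-characters ($\overline{\chi}_q(M)=[\Psi^{-1}]\sum_{\Phi}\dim(M_\Phi)[\Phi]$ for $M$ of highest $\ell$-weight $\Psi$, $M_\Phi$ the common generalized eigenspace of the $\phi_{i,r}^+$ with eigenvalues $\Phi_{i,r}$) converge to those of $V$, $W$ as formal power series in the $A_{i,a}^{-1}$, where $A_{i,a}=Y_{i,aq_i^{-1}}Y_{i,aq_i}\big(\prod_{C_{j,i}=-1}Y_{j,a}\prod_{C_{j,i}=-2}Y_{j,aq^{-1}}Y_{j,aq}\prod_{C_{j,i}=-3}Y_{j,aq^{-2}}Y_{j,a}Y_{j,aq^2}\big)^{-1}$. For $k\le\ell$, $G_{\ell,k}(u):V_k(u)\otimes W_k\to V_\ell(u)\otimes W_\ell$ is the composition of: (1) $v\otimes w\mapsto v\otimes w\otimes v_0\otimes w_0$ with $v_0,w_0$ highest $\ell$-weight vectors of $L_q(\Psi_\ell\Psi_k^{-1})(u)$ and $L_q(\Psi'_\ell(\Psi'_k)^{-1})$; (2) on the two middle factors, the inverse of the rational $R$-matrix $L_q(\Psi_\ell\Psi_k^{-1})(u)\otimes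 L_q(\Psi_k')\to L_q(\Psi_k')\otimes L_q(\Psi_\ell\Psi_k^{-1})(u)$; (3) the tensor product of the module morphisms $L_q(\Psi_k)\otimes L_q(\Psi_\ell\Psi_k^{-1})\to L_q(\Psi_\ell)$ (with spectral parameter $u$) and $L_q(\Psi'_k)\otimes L_q(\Psi'_\ell(\Psi'_k)^{-1})\to L_q(\Psi'_\ell)$ matching highest $\ell$-weight vectors. $G'_{\ell,k}(u):W_k\otimes V_k(u)\to W_\ell\otimes V_\ell(u)$ is defined analogously. By Hernandez these are inductive systems, on whose limits the action of the subalgebra of $U_q(\mathfrak{g})$ generated by $x_{i,r}^+,k_i^{-1}x_{i,r}^-,k_i^{-1}\phi_{i,r}^\pm,k_i^{-1}$ (which contains $e_0,\dots,e_n$) converges, giving (with the $k_i$-eigenvalues on highest $\ell$-weight vectors fixed by those of $V,W$) $U_{q,u}(\mathfrak{b})$-modules isomorphic to $V(u)\otimes W$ and $W\otimes V(u)$; let $G_{\infty,k}(u)$, $G'_{\infty,k}(u)$ be the canonical maps to the limits. There is a unique map $R_{V,W}(u):V(u)\otimes W\to W\otimes V(u)$ with $R_{V,W}(u)\circ G_{\infty,k}(u)=G'_{\infty,k}(u)\circ R_{V_k,W_k}(u)$ for all $k$; it is a $U_{q,u}(\mathfrak{b})$-linear isomorphism, called the affine $R$-matrix. Meaning of "produces". The underlying spaces of $V,W$ and $\mathcal{F}_{q^{-1}}(V),\mathcal{F}_{q^{-1}}(W)$ coincide. The map $\tau\circ R'(u^{-1})\circ\tau$ is considered first as a map $V\otimes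 W(u^{-1})\to W(u^{-1})\otimes V$, and then, by pulling back both modules by the automorphism $\tau_u$ of $U_{q,u}(\mathfrak{b})$, as a map $V(u)\otimes W\to W\otimes V(u)$. *)

theory Defs
  imports
    Complex_Main
    "HOL-Library.Poly_Mapping"
    "HOL-Computational_Algebra.Computational_Algebra"
    "HOL-Combinatorics.Permutations"
begin

section \<open>Based vector spaces\<close>

text \<open>
  A vector space over a field \<open>'k\<close> is presented by a basis: the space with basis
  \<open>B :: 'a set\<close> consists of the finitely supported functions \<open>'a \<Rightarrow>\<^sub>0 'k\<close> with support
  in \<open>B\<close>. Every vector space is of this form up to isomorphism, the tensor product of the
  spaces with bases \<open>B\<close> and \<open>B'\<close> is the space with basis \<open>B \<times> B'\<close>, and extension of
  scalars keeps the basis and changes the field.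
\<close>

definition vscale :: "'k::field \<Rightarrow> ('a \<Rightarrow>\<^sub>0 'k) \<Rightarrow> ('a \<Rightarrow>\<^sub>0 'k)" where
  "vscale c v = Poly_Mapping.map ((*) c) v"

lemma lookup_vscale: "Poly_Mapping.lookup (vscale c v) x = c * Poly_Mapping.lookup v x"
  by (simp add: vscale_def Poly_Mapping.map.rep_eq when_def)

lemma vector_space_vscale: "vector_space (vscale :: 'k::field \<Rightarrow> ('a \<Rightarrow>\<^sub>0 'k) \<Rightarrow> _)"
  by standard (auto intro!: poly_mapping_eqI simp: lookup_vscale lookup_add algebra_simps)

definition basis_vec :: "'a \<Rightarrow> ('a \<Rightarrow>\<^sub>0 'k::field)" where
  "basis_vec a = Poly_Mapping.single a 1"

definition vecs_on :: "'a set \<Rightarrow> ('a \<Rightarrow>\<^sub>0 'k::field) set" where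
  "vecs_on B = {v. Poly_Mapping.keys v \<subseteq> B}"

definition lin_ext :: "('a \<Rightarrow> ('b \<Rightarrow>\<^sub>0 'k)) \<Rightarrow> ('a \<Rightarrow>\<^sub>0 'k::field) \<Rightarrow> ('b \<Rightarrow>\<^sub>0 'k)" where
  "lin_ext f v = (\<Sum>a\<in>Poly_Mapping.keys v. vscale (Poly_Mapping.lookup v a) (f a))"

definition linear_map ::
  "('a \<Rightarrow>\<^sub>0 'k::field) set \<Rightarrow> ('b \<Rightarrow>\<^sub>0 'k) set \<Rightarrow> (('a \<Rightarrow>\<^sub>0 'k) \<Rightarrow> ('b \<Rightarrow>\<^sub>0 'k)) \<Rightarrow> bool" where
  "linear_map S T f \<longleftrightarrow>
     (\<forall>v\<in>S. f v \<in> T) \<and>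
     (\<forall>v\<in>S. \<forall>w\<in>S. f (v + w) = f v + f w) \<and>
     (\<forall>c. \<forall>v\<in>S. f (vscale c v) = vscale c (f v))"

definition tens :: "('a \<Rightarrow>\<^sub>0 'k::field) \<Rightarrow> ('b \<Rightarrow>\<^sub>0 'k) \<Rightarrow> ('a \<times> 'b \<Rightarrow>\<^sub>0 'k)" where
  "tens v w = (\<Sum>a\<in>Poly_Mapping.keys v. \<Sum>b\<in>Poly_Mapping.keys w.
     Poly_Mapping.single (a, b) (Poly_Mapping.lookup v a * Poly_Mapping.lookup w b))"

definition tens_map ::
  "(('a \<Rightarrow>\<^sub>0 'k::field) \<Rightarrow> ('c \<Rightarrow>\<^sub>0 'k)) \<Rightarrow> (('b \<Rightarrow>\<^sub>0 'k) \<Rightarrow> ('d \<Rightarrow>\<^sub>0 'k)) \<Rightarrow>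
   ('a \<times> 'b \<Rightarrow>\<^sub>0 'k) \<Rightarrow> ('c \<times> 'd \<Rightarrow>\<^sub>0 'k)" where
  "tens_map f g = lin_ext (\<lambda>(a, b). tens (f (basis_vec a)) (g (basis_vec b)))"

definition flip :: "('a \<times> 'b \<Rightarrow>\<^sub>0 'k::field) \<Rightarrow> ('b \<times> 'a \<Rightarrow>\<^sub>0 'k)" where
  "flip = lin_ext (\<lambda>(a, b). basis_vec (b, a))"

text \<open>The map \<open>id \<otimes> S \<otimes> id\<close> from \<open>(A \<otimes> B) \<otimes> (C \<otimes> D)\<close> to \<open>(A \<otimes> C) \<otimes> (B \<otimes> D)\<close>
  for \<open>S\<close> from \<open>B \<otimes> C\<close> to \<open>C \<otimes> B\<close>.\<close>

definition on_middle ::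
  "(('b \<times> 'c \<Rightarrow>\<^sub>0 'k::field) \<Rightarrow> ('c \<times> 'b \<Rightarrow>\<^sub>0 'k)) \<Rightarrow>
   (('a \<times> 'b) \<times> ('c \<times> 'd) \<Rightarrow>\<^sub>0 'k) \<Rightarrow> (('a \<times> 'c) \<times> ('b \<times> 'd) \<Rightarrow>\<^sub>0 'k)" where
  "on_middle S = lin_ext (\<lambda>((a, b), (c, d)).
     lin_ext (\<lambda>(c', b'). basis_vec ((a, c'), (b', d))) (S (basis_vec (b, c))))"


section \<open>Algebras given by generators and relations\<close>

text \<open>The free algebra on \<open>'g\<close> is the monoid algebra of the free monoid on \<open>'g\<close>.\<close>

datatype 'g fmonoid = Monom (letters: "'g list")

instantiation fmonoid :: (type) monoid_add
begin

definition zero_fmonoid :: "'a fmonoid" where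
  "zero_fmonoid = Monom []"

definition plus_fmonoid :: "'a fmonoid \<Rightarrow> 'a fmonoid \<Rightarrow> 'a fmonoid" where
  "plus_fmonoid v w = Monom (letters v @ letters w)"

instance
  by standard (simp_all add: zero_fmonoid_def plus_fmonoid_def)

end

type_synonym ('g, 'k) falg = "'g fmonoid \<Rightarrow>\<^sub>0 'k"

definition lett :: "'g \<Rightarrow> ('g, 'k::field) falg" where
  "lett g = Poly_Mapping.single (Monom [g]) 1"

definition scal :: "'k::field \<Rightarrow> ('g, 'k) falg" where
  "scal c = Poly_Mapping.single 0 c"

definition falg_on :: "'g set \<Rightarrow> ('g, 'k::field) falg set" where
  "falg_on S = {x. \<forall>w\<in>Poly_Mapping.keys x. set (letters w) \<subseteq> S}"

definition falg_hom :: "('g \<Rightarrow> ('h, 'k) falg) \<Rightarrow> ('g, 'k::field) falg \<Rightarrow> ('h, 'k) falg" where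
  "falg_hom \<phi> x = (\<Sum>w\<in>Poly_Mapping.keys x.
     scal (Poly_Mapping.lookup x w) * prod_list (map \<phi> (letters w)))"

text \<open>The two-sided ideal of the subalgebra \<open>A\<close> generated by \<open>S\<close>.\<close>

inductive_set ideal_gen :: "('g, 'k::field) falg set \<Rightarrow> ('g, 'k) falg set \<Rightarrow> ('g, 'k) falg set"
  for A S where
  zero: "0 \<in> ideal_gen A S"
| add: "x \<in> ideal_gen A S \<Longrightarrow> y \<in> ideal_gen A S \<Longrightarrow> x + y \<in> ideal_gen A S"
| gen: "x \<in> A \<Longrightarrow> y \<in> A \<Longrightarrow> s \<in> S \<Longrightarrow> x * s * y \<in> ideal_gen A S"


section \<open>Untwisted affine Cartan data\<close>

text \<open>\<open>rk\<close> is \<open>n\<close>, \<open>cm\<close> the Cartan matrix, \<open>dd\<close> the symmetrizers and \<open>aa\<close> the marks;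
  only indices in \<open>{0..n}\<close> matter.\<close>

record cartan =
  rk :: nat
  cm :: "nat \<Rightarrow> nat \<Rightarrow> int"
  dd :: "nat \<Rightarrow> nat"
  aa :: "nat \<Rightarrow> nat"

definition idx :: "cartan \<Rightarrow> nat set" where
  "idx X = {1..rk X}"

definition simple_root :: "nat \<Rightarrow> nat \<Rightarrow> int" where
  "simple_root i j = (if j = i then 1 else 0)"

text \<open>Roots of the simple Lie algebra with Cartan matrix \<open>(C\<^sub>i\<^sub>j)\<^sub>i\<^sub>,\<^sub>j\<^sub>\<in>\<^sub>I\<close>, as coordinate vectors
  with respect to the simple roots: the orbits of the simple roots under the simple reflections.\<close>

inductive_set fin_roots :: "cartan \<Rightarrow> (nat \<Rightarrow> int) set" for X where
  simple: "i \<in> idx X \<Longrightarrow> simple_root i \<in> fin_roots X"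
| refl: "\<beta> \<in> fin_roots X \<Longrightarrow> i \<in> idx X \<Longrightarrow>
    (\<lambda>l. \<beta> l - (\<Sum>j\<in>idx X. cm X i j * \<beta> j) * simple_root i l) \<in> fin_roots X"

text \<open>Being annihilated by a positive vector characterizes the affine types among the indecomposable
  generalized Cartan matrices. The last two conjuncts express that the affine type is untwisted:
  \<open>\<alpha>\<^sub>0 = \<delta> - \<theta>\<close> where \<open>\<theta> = \<Sum>\<^sub>i\<^sub>\<in>\<^sub>I a\<^sub>i \<alpha>\<^sub>i\<close> is the highest root of the underlying simple Lie
  algebra.\<close>

definition untwisted_affine :: "cartan \<Rightarrow> bool" where
  "untwisted_affine X \<longleftrightarrow>
     (\<forall>i\<le>rk X. cm X i i = 2) \<and>
     (\<forall>i\<le>rk X. \<forall>j\<le>rk X. i \<noteq> j \<longrightarrow> cm X i j \<le> 0 \<and> (cm X i j = 0 \<longleftrightarrow> cm X j i = 0)) \<and>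
     (\<forall>J. J \<subseteq> {0..rk X} \<and> J \<noteq> {} \<and> (\<forall>i\<in>J. \<forall>j\<in>{0..rk X} - J. cm X i j = 0) \<longrightarrow> J = {0..rk X}) \<and>
     (\<forall>i\<le>rk X. 0 < dd X i) \<and> Gcd (dd X ` {0..rk X}) = 1 \<and>
     (\<forall>i\<le>rk X. \<forall>j\<le>rk X. int (dd X i) * cm X i j = int (dd X j) * cm X j i) \<and>
     (\<forall>i\<le>rk X. 0 < aa X i) \<and> Gcd (aa X ` {0..rk X}) = 1 \<and>
     (\<forall>i\<le>rk X. (\<Sum>j\<le>rk X. cm X i j * int (aa X j)) = 0) \<and>
     aa X 0 = 1 \<and>
     (\<lambda>i. if i \<in> idx X then int (aa X i) else 0) \<in> fin_roots X \<and>
     (\<forall>\<beta>\<in>fin_roots X. \<forall>i\<in>idx X. \<beta> i \<le> int (aa X i))"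

definition qnum :: "'k::field \<Rightarrow> int \<Rightarrow> 'k" where
  "qnum x m = (x powi m - x powi (- m)) / (x - inverse x)"

definition qfact :: "'k::field \<Rightarrow> nat \<Rightarrow> 'k" where
  "qfact x m = (\<Prod>r=1..m. qnum x (int r))"

definition qbinom :: "'k::field \<Rightarrow> nat \<Rightarrow> nat \<Rightarrow> 'k" where
  "qbinom x m r = qfact x m / (qfact x r * qfact x (m - r))"

definition qi :: "cartan \<Rightarrow> 'k::field \<Rightarrow> nat \<Rightarrow> 'k" where
  "qi X q i = q ^ dd X i"


section \<open>The quantum loop algebra and its Borel subalgebra\<close>

datatype gen = E nat | F nat | K nat | Kinv nat

definition letters_g :: "cartan \<Rightarrow> gen set" where
  "letters_g X = E ` {0..rk X} \<union> F ` {0..rk X} \<union> K ` {0..rk X} \<union> Kinv ` {0..rk X}"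

definition letters_b :: "cartan \<Rightarrow> gen set" where
  "letters_b X = E ` {0..rk X} \<union> K ` {0..rk X} \<union> Kinv ` {0..rk X}"

definition serre :: "cartan \<Rightarrow> 'k::field \<Rightarrow> (nat \<Rightarrow> gen) \<Rightarrow> nat \<Rightarrow> nat \<Rightarrow> (gen, 'k) falg" where
  "serre X q x i j =
     (let N = nat (1 - cm X i j);
          dp = (\<lambda>r. scal (1 / qfact (qi X q i) r) * lett (x i) ^ r)
      in \<Sum>r\<le>N. scal ((- 1) ^ r) * dp (N - r) * lett (x j) * dp r)"

text \<open>The defining relations, each written as an element of the free algebra to be set to zero.
  With \<open>'k\<close> the field of rational functions and \<open>q\<close> a constant they present
  \<open>U\<^sub>q\<^sub>,\<^sub>u(g) = U\<^sub>q(g) \<otimes> \<complex>(u)\<close>.\<close>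

definition uq_rels :: "cartan \<Rightarrow> 'k::field \<Rightarrow> (gen, 'k) falg set" where
  "uq_rels X q =
     {lett (K i) * lett (K j) - lett (K j) * lett (K i) | i j. i \<le> rk X \<and> j \<le> rk X} \<union>
     {lett (K i) * lett (Kinv i) - 1 | i. i \<le> rk X} \<union>
     {lett (Kinv i) * lett (K i) - 1 | i. i \<le> rk X} \<union>
     {prod_list (map (\<lambda>i. lett (K i) ^ aa X i) [0..<Suc (rk X)]) - 1} \<union>
     {lett (K i) * lett (E j) * lett (Kinv i) - scal (qi X q i powi cm X i j) * lett (E j)
        | i j. i \<le> rk X \<and> j \<le> rk X} \<union>
     {lett (K i) * lett (F j) * lett (Kinv i) - scal (qi X q i powi (- cm X i j)) * lett (F j)
        | i j. i \<le> rk X \<and> j \<le> rk X} \<union>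
     {lett (E i) * lett (F j) - lett (F j) * lett (E i) -
        (if i = j then scal (1 / (qi X q i - inverse (qi X q i))) * (lett (K i) - lett (Kinv i)) else 0)
        | i j. i \<le> rk X \<and> j \<le> rk X} \<union>
     {serre X q E i j | i j. i \<le> rk X \<and> j \<le> rk X \<and> i \<noteq> j} \<union>
     {serre X q F i j | i j. i \<le> rk X \<and> j \<le> rk X \<and> i \<noteq> j}"

text \<open>\<open>U\<^sub>q(g)\<close> is the quotient of \<open>falg_on (letters_g X)\<close> by this ideal; its elements are
  handled through representatives.\<close>

definition uq_ideal :: "cartan \<Rightarrow> 'k::field \<Rightarrow> (gen, 'k) falg set" where
  "uq_ideal X q = ideal_gen (falg_on (letters_g X)) (uq_rels X q)"

definition uq_eq :: "cartan \<Rightarrow> 'k::field \<Rightarrow> (gen, 'k) falg \<Rightarrow> (gen, 'k) falg \<Rightarrow> bool" where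
  "uq_eq X q x y \<longleftrightarrow> x - y \<in> uq_ideal X q"

fun gen_deg :: "gen \<Rightarrow> int" where
  "gen_deg (E i) = (if i = 0 then 1 else 0)"
| "gen_deg (F i) = (if i = 0 then - 1 else 0)"
| "gen_deg (K i) = 0"
| "gen_deg (Kinv i) = 0"

definition homogeneous :: "int \<Rightarrow> (gen, 'k::field) falg \<Rightarrow> bool" where
  "homogeneous r x \<longleftrightarrow> (\<forall>w\<in>Poly_Mapping.keys x. sum_list (map gen_deg (letters w)) = r)"

text \<open>The coproduct of a generator, as a list of pure tensors.\<close>

fun coprod :: "gen \<Rightarrow> ((gen, 'k::field) falg \<times> (gen, 'k) falg) list" where
  "coprod (E i) = [(lett (E i), 1), (lett (K i), lett (E i))]"
| "coprod (F i) = [(lett (F i), lett (Kinv i)), (1, lett (F i))]"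
| "coprod (K i) = [(lett (K i), lett (K i))]"
| "coprod (Kinv i) = [(lett (Kinv i), lett (Kinv i))]"


section \<open>The second presentation\<close>

text \<open>The letters \<open>HH i m\<close> stand for \<open>h\<^sub>i\<^sub>,\<^sub>m\<close>, and \<open>k\<^sub>i\<close>, \<open>k\<^sub>i\<^sup>-\<^sup>1\<close> are \<open>\<phi>\<^sup>+\<^sub>i\<^sub>,\<^sub>0\<close>, \<open>\<phi>\<^sup>-\<^sub>i\<^sub>,\<^sub>0\<close>.\<close>

datatype dgen = XP nat int | XM nat int | PhP nat int | PhM nat int | HH nat int

definition letters_d :: "cartan \<Rightarrow> dgen set" where
  "letters_d X = (\<Union>i\<in>idx X. range (XP i) \<union> range (XM i) \<union> range (PhP i) \<union> range (PhM i) \<union>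
     HH i ` (UNIV - {0}))"

text \<open>\<open>dx 1\<close>, \<open>dx (-1)\<close> are \<open>x\<^sup>+\<close>, \<open>x\<^sup>-\<close>, and similarly for \<open>dphi\<close>.\<close>

definition dx :: "int \<Rightarrow> nat \<Rightarrow> int \<Rightarrow> (dgen, complex) falg" where
  "dx s i r = lett (if s = 1 then XP i r else XM i r)"

definition dphi :: "int \<Rightarrow> nat \<Rightarrow> int \<Rightarrow> (dgen, complex) falg" where
  "dphi s i r = lett (if s = 1 then PhP i r else PhM i r)"

text \<open>The coefficient of \<open>z\<^sup>m\<close> in \<open>exp (s (q\<^sub>i - q\<^sub>i\<^sup>-\<^sup>1) \<Sum>\<^sub>r\<^sub>>\<^sub>0 h\<^sub>i\<^sub>,\<^sub>s\<^sub>r z\<^sup>r)\<close>, the substitution of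
  \<open>z\<close> for \<open>z\<^sup>s\<close> being harmless. The exponent has no constant term, so the terms of the exponential
  series beyond the \<open>m\<close>-th do not contribute.\<close>

definition exp_h_coeff :: "cartan \<Rightarrow> complex \<Rightarrow> int \<Rightarrow> nat \<Rightarrow> nat \<Rightarrow> (dgen, complex) falg" where
  "exp_h_coeff X q s i m =
     (let A = Abs_fps (\<lambda>r. if r = 0 then 0
                 else scal (of_int s * (qi X q i - inverse (qi X q i))) * lett (HH i (s * int r)))
      in fps_nth (\<Sum>p\<le>m. fps_const (scal (1 / fact p)) * A ^ p) m)"

definition drinfeld_serre ::
  "cartan \<Rightarrow> complex \<Rightarrow> int \<Rightarrow> nat \<Rightarrow> nat \<Rightarrow> (nat \<Rightarrow> int) \<Rightarrow> int \<Rightarrow> (dgen, complex) falg" where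
  "drinfeld_serre X q s i j r r' =
     (let N = nat (1 - cm X i j)
      in \<Sum>\<pi> | \<pi> permutes {0..<N}. \<Sum>l\<le>N. scal ((- 1) ^ l * qbinom (qi X q i) N l) *
           prod_list (map (\<lambda>t. dx s i (r (\<pi> t))) [0..<l]) * dx s j r' *
           prod_list (map (\<lambda>t. dx s i (r (\<pi> t))) [l..<N]))"

definition drinfeld_rels :: "cartan \<Rightarrow> complex \<Rightarrow> (dgen, complex) falg set" where
  "drinfeld_rels X q =
     {dphi s i m * dphi s' j m' - dphi s' j m' * dphi s i m
        | s s' i j m m'. s \<in> {1, -1} \<and> s' \<in> {1, -1} \<and> i \<in> idx X \<and> j \<in> idx X} \<union>
     {dphi 1 i 0 * dphi (- 1) i 0 - 1 | i. i \<in> idx X} \<union>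
     {dphi s i (s * m) | s i m. s \<in> {1, -1} \<and> i \<in> idx X \<and> m < 0} \<union>
     {dphi 1 i 0 * dx s j r * dphi (- 1) i 0 - scal (qi X q i powi (s * cm X i j)) * dx s j r
        | s i j r. s \<in> {1, -1} \<and> i \<in> idx X \<and> j \<in> idx X} \<union>
     {lett (HH i m) * dx s j r - dx s j r * lett (HH i m) -
        scal (of_int s / of_int m * qnum (qi X q i) (m * cm X i j)) * dx s j (r + m)
        | s i j m r. s \<in> {1, -1} \<and> i \<in> idx X \<and> j \<in> idx X \<and> m \<noteq> 0} \<union>
     {dphi s i (s * int m) - dphi s i 0 * exp_h_coeff X q s i m
        | s i m. s \<in> {1, -1} \<and> i \<in> idx X} \<union>
     {dx 1 i r * dx (- 1) j t - dx (- 1) j t * dx 1 i r -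
        (if i = j then scal (1 / (qi X q i - inverse (qi X q i))) *
                       (dphi 1 i (r + t) - dphi (- 1) i (r + t)) else 0)
        | i j r t. i \<in> idx X \<and> j \<in> idx X} \<union>
     {dx s i (r + 1) * dx s j t - scal (qi X q i powi (s * cm X i j)) * dx s j t * dx s i (r + 1) -
        (scal (qi X q i powi (s * cm X i j)) * dx s i r * dx s j (t + 1) - dx s j (t + 1) * dx s i r)
        | s i j r t. s \<in> {1, -1} \<and> i \<in> idx X \<and> j \<in> idx X} \<union>
     {drinfeld_serre X q s i j r r'
        | s i j r r'. s \<in> {1, -1} \<and> i \<in> idx X \<and> j \<in> idx X \<and> i \<noteq> j}"

definition drinfeld_ideal :: "cartan \<Rightarrow> complex \<Rightarrow> (dgen, complex) falg set" where
  "drinfeld_ideal X q = ideal_gen (falg_on (letters_d X)) (drinfeld_rels X q)"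

text \<open>\<open>\<theta>\<close> gives representatives in the free algebra of the images of the Drinfeld generators under an
  isomorphism of the two presented algebras. The elements \<open>\<phi>\<^sup>+\<^sub>i\<^sub>,\<^sub>r\<close> lie in the Borel
  subalgebra, and their representatives are chosen there so that they act on its modules.\<close>

definition drinfeld_correspondence :: "cartan \<Rightarrow> complex \<Rightarrow> (dgen \<Rightarrow> (gen, complex) falg) \<Rightarrow> bool" where
  "drinfeld_correspondence X q \<theta> \<longleftrightarrow>
     (\<forall>g\<in>letters_d X. \<theta> g \<in> falg_on (letters_g X)) \<and>
     (\<forall>x\<in>falg_on (letters_d X). falg_hom \<theta> x \<in> uq_ideal X q \<longleftrightarrow> x \<in> drinfeld_ideal X q) \<and>
     (\<forall>y\<in>falg_on (letters_g X). \<exists>x\<in>falg_on (letters_d X). uq_eq X q y (falg_hom \<theta> x)) \<and>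
     (\<forall>i\<in>idx X. uq_eq X q (\<theta> (XP i 0)) (lett (E i)) \<and> uq_eq X q (\<theta> (XM i 0)) (lett (F i)) \<and>
        uq_eq X q (\<theta> (PhP i 0)) (lett (K i)) \<and> uq_eq X q (\<theta> (PhM i 0)) (lett (Kinv i))) \<and>
     (\<forall>i\<in>idx X. \<forall>r. \<forall>g\<in>{XP i r, XM i r, PhP i r, PhM i r}.
        \<exists>y\<in>falg_on (letters_g X). homogeneous r y \<and> uq_eq X q (\<theta> g) y) \<and>
     (\<forall>i\<in>idx X. \<forall>r\<ge>0. \<theta> (PhP i r) \<in> falg_on (letters_b X))"


section \<open>Modules\<close>

text \<open>Modules are given by a basis and the operators of the generators. For modules over the
  Borel subalgebra the operators of the letters \<open>F i\<close> carry no information.\<close>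

record (overloaded) ('a, 'k::zero) qmod =
  basis :: "'a set"
  act :: "gen \<Rightarrow> ('a \<Rightarrow>\<^sub>0 'k) \<Rightarrow> ('a \<Rightarrow>\<^sub>0 'k)"

definition space :: "('a, 'k::field) qmod \<Rightarrow> ('a \<Rightarrow>\<^sub>0 'k) set" where
  "space M = vecs_on (basis M)"

definition word_act :: "('a, 'k::field) qmod \<Rightarrow> gen fmonoid \<Rightarrow> ('a \<Rightarrow>\<^sub>0 'k) \<Rightarrow> ('a \<Rightarrow>\<^sub>0 'k)" where
  "word_act M w v = foldr (act M) (letters w) v"

definition ev :: "('a, 'k::field) qmod \<Rightarrow> (gen, 'k) falg \<Rightarrow> ('a \<Rightarrow>\<^sub>0 'k) \<Rightarrow> ('a \<Rightarrow>\<^sub>0 'k)" where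
  "ev M x v = (\<Sum>w\<in>Poly_Mapping.keys x. vscale (Poly_Mapping.lookup x w) (word_act M w v))"

definition g_module :: "cartan \<Rightarrow> 'k::field \<Rightarrow> ('a, 'k) qmod \<Rightarrow> bool" where
  "g_module X q M \<longleftrightarrow>
     (\<forall>g\<in>letters_g X. linear_map (space M) (space M) (act M g)) \<and>
     (\<forall>x\<in>uq_ideal X q. \<forall>v\<in>space M. ev M x v = 0)"

text \<open>The Borel subalgebra of the quotient algebra is the image of \<open>falg_on (letters_b X)\<close>.\<close>

definition b_module :: "cartan \<Rightarrow> 'k::field \<Rightarrow> ('a, 'k) qmod \<Rightarrow> bool" where
  "b_module X q M \<longleftrightarrow>
     (\<forall>g\<in>letters_b X. linear_map (space M) (space M) (act M g)) \<and>
     (\<forall>x\<in>uq_ideal X q \<inter> falg_on (letters_b X). \<forall>v\<in>space M. ev M x v = 0)"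

definition module_map ::
  "gen set \<Rightarrow> ('a, 'k::field) qmod \<Rightarrow> ('b, 'k) qmod \<Rightarrow> (('a \<Rightarrow>\<^sub>0 'k) \<Rightarrow> ('b \<Rightarrow>\<^sub>0 'k)) \<Rightarrow> bool" where
  "module_map S M N f \<longleftrightarrow>
     linear_map (space M) (space N) f \<and>
     (\<forall>x\<in>falg_on S. \<forall>v\<in>space M. f (ev M x v) = ev N x (f v))"

definition g_iso ::
  "cartan \<Rightarrow> ('a, 'k::field) qmod \<Rightarrow> ('b, 'k) qmod \<Rightarrow> (('a \<Rightarrow>\<^sub>0 'k) \<Rightarrow> ('b \<Rightarrow>\<^sub>0 'k)) \<Rightarrow> bool" where
  "g_iso X M N f \<longleftrightarrow> module_map (letters_g X) M N f \<and> bij_betw f (space M) (space N)"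

definition b_iso ::
  "cartan \<Rightarrow> ('a, 'k::field) qmod \<Rightarrow> ('b, 'k) qmod \<Rightarrow> (('a \<Rightarrow>\<^sub>0 'k) \<Rightarrow> ('b \<Rightarrow>\<^sub>0 'k)) \<Rightarrow> bool" where
  "b_iso X M N f \<longleftrightarrow> module_map (letters_b X) M N f \<and> bij_betw f (space M) (space N)"

text \<open>Pullback along the algebra morphism with prescribed values on the generators.\<close>

definition pullback :: "(gen \<Rightarrow> (gen, 'k) falg) \<Rightarrow> ('a, 'k::field) qmod \<Rightarrow> ('a, 'k) qmod" where
  "pullback \<phi> M = \<lparr>basis = basis M, act = (\<lambda>g. ev M (\<phi> g))\<rparr>"

definition tensor :: "('a, 'k::field) qmod \<Rightarrow> ('b, 'k) qmod \<Rightarrow> ('a \<times> 'b, 'k) qmod" where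
  "tensor M N =
     \<lparr>basis = basis M \<times> basis N,
      act = (\<lambda>g. lin_ext (\<lambda>(a, b).
        (\<Sum>(x, y)\<leftarrow>coprod g. tens (ev M x (basis_vec a)) (ev N y (basis_vec b)))))\<rparr>"

definition submodule :: "cartan \<Rightarrow> ('a, 'k::field) qmod \<Rightarrow> ('a \<Rightarrow>\<^sub>0 'k) set \<Rightarrow> bool" where
  "submodule X M N \<longleftrightarrow>
     N \<subseteq> space M \<and> 0 \<in> N \<and> (\<forall>v\<in>N. \<forall>w\<in>N. v + w \<in> N) \<and> (\<forall>c. \<forall>v\<in>N. vscale c v \<in> N) \<and>
     (\<forall>x\<in>falg_on (letters_b X). \<forall>v\<in>N. ev M x v \<in> N)"

definition simple_module :: "cartan \<Rightarrow> ('a, 'k::field) qmod \<Rightarrow> bool" where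
  "simple_module X M \<longleftrightarrow>
     space M \<noteq> {0} \<and> (\<forall>N. submodule X M N \<longrightarrow> N = {0} \<or> N = space M)"


section \<open>The spectral parameter\<close>

type_synonym ratfun = "complex poly fract"

definition cu :: "complex \<Rightarrow> ratfun" where
  "cu c = to_fract [:c:]"

definition uu :: ratfun where
  "uu = to_fract [:0, 1:]"

definition extend_vec :: "('a \<Rightarrow>\<^sub>0 complex) \<Rightarrow> ('a \<Rightarrow>\<^sub>0 ratfun)" where
  "extend_vec v = Poly_Mapping.map cu v"

definition extend_map ::
  "(('a \<Rightarrow>\<^sub>0 complex) \<Rightarrow> ('b \<Rightarrow>\<^sub>0 complex)) \<Rightarrow> ('a \<Rightarrow>\<^sub>0 ratfun) \<Rightarrow> ('b \<Rightarrow>\<^sub>0 ratfun)" where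
  "extend_map f = lin_ext (\<lambda>a. extend_vec (f (basis_vec a)))"

definition ext_scal :: "('a, complex) qmod \<Rightarrow> ('a, ratfun) qmod" where
  "ext_scal M = \<lparr>basis = basis M, act = (\<lambda>g. extend_map (act M g))\<rparr>"

fun tau :: "ratfun \<Rightarrow> gen \<Rightarrow> (gen, ratfun) falg" where
  "tau t (E i) = (if i = 0 then scal t else 1) * lett (E i)"
| "tau t (F i) = (if i = 0 then scal (inverse t) else 1) * lett (F i)"
| "tau t (K i) = lett (K i)"
| "tau t (Kinv i) = lett (Kinv i)"

definition spectral :: "ratfun \<Rightarrow> ('a, complex) qmod \<Rightarrow> ('a, ratfun) qmod" where
  "spectral t M = pullback (tau t) (ext_scal M)"

text \<open>The automorphism of \<open>\<complex>(u)\<close> substituting \<open>u\<^sup>-\<^sup>1\<close> for \<open>u\<close>.\<close>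

definition subst_u_inv :: "ratfun \<Rightarrow> ratfun" where
  "subst_u_inv x = (THE y. \<exists>p r. r \<noteq> 0 \<and> x = Fract p r \<and>
     y = poly (map_poly cu p) (inverse uu) / poly (map_poly cu r) (inverse uu))"

definition subst_vec :: "('a \<Rightarrow>\<^sub>0 ratfun) \<Rightarrow> ('a \<Rightarrow>\<^sub>0 ratfun)" where
  "subst_vec v = Poly_Mapping.map subst_u_inv v"

text \<open>The linear map whose matrix is obtained from that of \<open>R\<close> by substituting \<open>u\<^sup>-\<^sup>1\<close> for \<open>u\<close>.\<close>

definition at_u_inv ::
  "(('a \<Rightarrow>\<^sub>0 ratfun) \<Rightarrow> ('b \<Rightarrow>\<^sub>0 ratfun)) \<Rightarrow> ('a \<Rightarrow>\<^sub>0 ratfun) \<Rightarrow> ('b \<Rightarrow>\<^sub>0 ratfun)" where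
  "at_u_inv R = subst_vec \<circ> R \<circ> subst_vec"


section \<open>Highest \<open>\<ell>\<close>-weights and category \<open>\<O>\<close>\<close>

text \<open>Weights and \<open>\<ell>\<close>-weights are families indexed by \<open>I\<close>, normalized to be \<open>1\<close> outside \<open>I\<close>.
  Rational functions regular at \<open>0\<close> are identified with their expansions at \<open>0\<close>.\<close>

type_synonym lweight = "nat \<Rightarrow> complex fps"

definition lw_one :: lweight where
  "lw_one = (\<lambda>i. 1)"

definition lw_mult :: "lweight \<Rightarrow> lweight \<Rightarrow> lweight" where
  "lw_mult \<Psi> \<Phi> = (\<lambda>i. \<Psi> i * \<Phi> i)"

definition lw_inv :: "lweight \<Rightarrow> lweight" where
  "lw_inv \<Psi> = (\<lambda>i. inverse (\<Psi> i))"

definition lweights :: "cartan \<Rightarrow> lweight set" where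
  "lweights X = {\<Psi>.
     (\<forall>i\<in>idx X. fps_nth (\<Psi> i) 0 \<noteq> 0 \<and>
        (\<exists>p r. coeff r 0 \<noteq> 0 \<and> fps_of_poly r * \<Psi> i = fps_of_poly p)) \<and>
     (\<forall>i. i \<notin> idx X \<longrightarrow> \<Psi> i = 1)}"

definition const_lweights :: "cartan \<Rightarrow> lweight set" where
  "const_lweights X = {\<Psi>. (\<forall>i\<in>idx X. \<exists>c. c \<noteq> 0 \<and> \<Psi> i = fps_const c) \<and> (\<forall>i. i \<notin> idx X \<longrightarrow> \<Psi> i = 1)}"

definition Psi_lw :: "nat \<Rightarrow> complex \<Rightarrow> lweight" where
  "Psi_lw i a = (\<lambda>j. if j = i then 1 - fps_const a * fps_X else 1)"

text \<open>The image in the weight group of the fundamental weight \<open>\<omega>\<^sub>i\<close>.\<close>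

definition omega_bar :: "cartan \<Rightarrow> complex \<Rightarrow> nat \<Rightarrow> lweight" where
  "omega_bar X q i = (\<lambda>j. if j = i then fps_const (qi X q i) else 1)"

definition Y_lw :: "cartan \<Rightarrow> complex \<Rightarrow> nat \<Rightarrow> complex \<Rightarrow> lweight" where
  "Y_lw X q i a =
     lw_mult (omega_bar X q i)
       (lw_mult (Psi_lw i (a * inverse (qi X q i))) (lw_inv (Psi_lw i (a * qi X q i))))"

definition A_lw :: "cartan \<Rightarrow> complex \<Rightarrow> nat \<Rightarrow> complex \<Rightarrow> lweight" where
  "A_lw X q i a = (\<lambda>l.
     Y_lw X q i (a * inverse (qi X q i)) l * Y_lw X q i (a * qi X q i) l *
     inverse
       ((\<Prod>j\<in>{j \<in> idx X. cm X j i = -1}. Y_lw X q j a l) *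
        (\<Prod>j\<in>{j \<in> idx X. cm X j i = -2}. Y_lw X q j (a * inverse q) l * Y_lw X q j (a * q) l) *
        (\<Prod>j\<in>{j \<in> idx X. cm X j i = -3}.
           Y_lw X q j (a * inverse (q\<^sup>2)) l * Y_lw X q j a l * Y_lw X q j (a * q\<^sup>2) l)))"

inductive_set monomials :: "lweight set \<Rightarrow> lweight set" for S where
  one: "lw_one \<in> monomials S"
| mult: "m \<in> monomials S \<Longrightarrow> s \<in> S \<Longrightarrow> lw_mult m s \<in> monomials S"

definition Y_set :: "cartan \<Rightarrow> complex \<Rightarrow> lweight set" where
  "Y_set X q = {Y_lw X q i a | i a. i \<in> idx X \<and> a \<noteq> 0}"

definition plus_lweights :: "cartan \<Rightarrow> complex \<Rightarrow> lweight set" where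
  "plus_lweights X q = monomials
     (Y_set X q \<union> {Psi_lw i a | i a. i \<in> idx X \<and> a \<noteq> 0} \<union> const_lweights X)"

definition minus_lweights :: "cartan \<Rightarrow> complex \<Rightarrow> lweight set" where
  "minus_lweights X q = monomials
     (Y_set X q \<union> {lw_inv (Psi_lw i a) | i a. i \<in> idx X \<and> a \<noteq> 0} \<union> const_lweights X)"

definition weight_space :: "cartan \<Rightarrow> ('a, complex) qmod \<Rightarrow> (nat \<Rightarrow> complex) \<Rightarrow> ('a \<Rightarrow>\<^sub>0 complex) set" where
  "weight_space X M \<mu> = {v \<in> space M. \<forall>i\<in>idx X. act M (K i) v = vscale (\<mu> i) v}"

definition t_group :: "cartan \<Rightarrow> (nat \<Rightarrow> complex) set" where
  "t_group X = {\<mu>. (\<forall>i\<in>idx X. \<mu> i \<noteq> 0) \<and> (\<forall>i. i \<notin> idx X \<longrightarrow> \<mu> i = 1)}"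

text \<open>\<open>\<mu> \<le> \<nu>\<close>: the quotient \<open>\<nu> \<mu>\<^sup>-\<^sup>1\<close> is the image of some \<open>\<Sum>\<^sub>i c\<^sub>i \<alpha>\<^sub>i\<close> with
  \<open>c\<^sub>i \<in> \<nat>\<close>, and the image of \<open>\<alpha>\<^sub>i = \<Sum>\<^sub>j C\<^sub>j\<^sub>i \<omega>\<^sub>j\<close> has \<open>j\<close>-th component \<open>q\<^sub>j\<close> to the power \<open>C\<^sub>j\<^sub>i\<close>.\<close>

definition weight_le :: "cartan \<Rightarrow> complex \<Rightarrow> (nat \<Rightarrow> complex) \<Rightarrow> (nat \<Rightarrow> complex) \<Rightarrow> bool" where
  "weight_le X q \<mu> \<nu> \<longleftrightarrow>
     (\<exists>c :: nat \<Rightarrow> nat. \<forall>j\<in>idx X. \<nu> j * inverse (\<mu> j) =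
        qi X q j powi (\<Sum>i\<in>idx X. cm X j i * int (c i)))"

definition in_O :: "cartan \<Rightarrow> complex \<Rightarrow> ('a, complex) qmod \<Rightarrow> bool" where
  "in_O X q M \<longleftrightarrow>
     b_module X q M \<and>
     space M \<subseteq> module.span vscale (\<Union>\<mu>\<in>t_group X. weight_space X M \<mu>) \<and>
     (\<forall>\<mu>\<in>t_group X. \<exists>B. finite B \<and> weight_space X M \<mu> \<subseteq> module.span vscale B) \<and>
     (\<exists>L. finite L \<and> L \<subseteq> t_group X \<and>
        (\<forall>\<mu>\<in>t_group X. weight_space X M \<mu> \<noteq> {0} \<longrightarrow> (\<exists>\<nu>\<in>L. weight_le X q \<mu> \<nu>)))"

definition highest_vec ::
  "cartan \<Rightarrow> (dgen \<Rightarrow> (gen, complex) falg) \<Rightarrow> ('a, complex) qmod \<Rightarrow> lweight \<Rightarrow>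
   ('a \<Rightarrow>\<^sub>0 complex) \<Rightarrow> bool" where
  "highest_vec X \<theta> M \<Psi> v \<longleftrightarrow>
     v \<in> space M \<and> v \<noteq> 0 \<and> (\<forall>i\<in>idx X. act M (E i) v = 0) \<and>
     (\<forall>i\<in>idx X. \<forall>r. ev M (\<theta> (PhP i (int r))) v = vscale (fps_nth (\<Psi> i) r) v)"

text \<open>\<open>M\<close> is \<open>L\<^sub>q(\<Psi>)\<close>, with highest \<open>\<ell>\<close>-weight vector \<open>v\<close>.\<close>

definition is_L ::
  "cartan \<Rightarrow> complex \<Rightarrow> (dgen \<Rightarrow> (gen, complex) falg) \<Rightarrow> lweight \<Rightarrow> ('a, complex) qmod \<Rightarrow>
   ('a \<Rightarrow>\<^sub>0 complex) \<Rightarrow> bool" where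
  "is_L X q \<theta> \<Psi> M v \<longleftrightarrow>
     \<Psi> \<in> lweights X \<and> b_module X q M \<and> simple_module X M \<and> highest_vec X \<theta> M \<Psi> v \<and>
     space M = (\<lambda>x. ev M x v) ` falg_on (letters_b X)"

text \<open>\<open>L\<^sub>q(\<Psi>)\<close> is a simple constituent of \<open>M\<close>: there are submodules \<open>N' \<subset> N\<close> of \<open>M\<close> with
  \<open>N / N'\<close> simple and generated by a vector of highest \<open>\<ell>\<close>-weight \<open>\<Psi>\<close>.\<close>

definition constituent ::
  "cartan \<Rightarrow> (dgen \<Rightarrow> (gen, complex) falg) \<Rightarrow> ('a, complex) qmod \<Rightarrow> lweight \<Rightarrow> bool" where
  "constituent X \<theta> M \<Psi> \<longleftrightarrow>
     \<Psi> \<in> lweights X \<and>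
     (\<exists>N N'. submodule X M N \<and> submodule X M N' \<and> N' \<subset> N \<and>
        (\<forall>N''. submodule X M N'' \<and> N' \<subseteq> N'' \<and> N'' \<subseteq> N \<longrightarrow> N'' = N' \<or> N'' = N) \<and>
        (\<exists>v\<in>N - N'. (\<forall>i\<in>idx X. act M (E i) v \<in> N') \<and>
           (\<forall>i\<in>idx X. \<forall>r. ev M (\<theta> (PhP i (int r))) v - vscale (fps_nth (\<Psi> i) r) v \<in> N')))"

definition in_O_plus ::
  "cartan \<Rightarrow> complex \<Rightarrow> (dgen \<Rightarrow> (gen, complex) falg) \<Rightarrow> ('a, complex) qmod \<Rightarrow> bool" where
  "in_O_plus X q \<theta> M \<longleftrightarrow>
     in_O X q M \<and> (\<forall>\<Psi>. constituent X \<theta> M \<Psi> \<longrightarrow> \<Psi> \<in> plus_lweights X q)"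

definition in_O_minus ::
  "cartan \<Rightarrow> complex \<Rightarrow> (dgen \<Rightarrow> (gen, complex) falg) \<Rightarrow> ('a, complex) qmod \<Rightarrow> bool" where
  "in_O_minus X q \<theta> M \<longleftrightarrow>
     in_O X q M \<and> (\<forall>\<Psi>. constituent X \<theta> M \<Psi> \<longrightarrow> \<Psi> \<in> minus_lweights X q)"


section \<open>The functor between the categories for \<open>q\<close> and its inverse\<close>

text \<open>The formulas for \<open>\<sigma>\<^sub>q\<close> do not depend on \<open>q\<close>, so this single map serves for \<open>\<sigma>\<^sub>q\<close> and its
  inverse, and \<open>functor_F\<close> for the pullback functors in both directions.\<close>

fun sigma :: "gen \<Rightarrow> (gen, complex) falg" where
  "sigma (E i) = - (lett (Kinv i) * lett (E i))"
| "sigma (F i) = - (lett (F i) * lett (K i))"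
| "sigma (K i) = lett (Kinv i)"
| "sigma (Kinv i) = lett (K i)"

definition functor_F :: "('a, complex) qmod \<Rightarrow> ('a, complex) qmod" where
  "functor_F M = pullback sigma M"


section \<open>Rational \<open>R\<close>-matrices of finite-dimensional modules\<close>

definition fd_simple ::
  "cartan \<Rightarrow> complex \<Rightarrow> (dgen \<Rightarrow> (gen, complex) falg) \<Rightarrow> lweight \<Rightarrow> ('a, complex) qmod \<Rightarrow>
   ('a \<Rightarrow>\<^sub>0 complex) \<Rightarrow> bool" where
  "fd_simple X q \<theta> \<Psi> M v \<longleftrightarrow>
     \<Psi> \<in> monomials (Y_set X q) \<and> g_module X q M \<and> finite (basis M) \<and> is_L X q \<theta> \<Psi> M v"

definition rational_R ::
  "cartan \<Rightarrow> ('a, complex) qmod \<Rightarrow> ('a \<Rightarrow>\<^sub>0 complex) \<Rightarrow> ('b, complex) qmod \<Rightarrow> ('b \<Rightarrow>\<^sub>0 complex) \<Rightarrow>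
   (('a \<times> 'b \<Rightarrow>\<^sub>0 ratfun) \<Rightarrow> ('b \<times> 'a \<Rightarrow>\<^sub>0 ratfun)) \<Rightarrow> bool" where
  "rational_R X A v B w R \<longleftrightarrow>
     g_iso X (tensor (spectral uu A) (ext_scal B)) (tensor (ext_scal B) (spectral uu A)) R \<and>
     R (tens (extend_vec v) (extend_vec w)) = tens (extend_vec w) (extend_vec v)"


section \<open>Finite-dimensional approximations and their limits\<close>

definition lweight_space ::
  "cartan \<Rightarrow> (dgen \<Rightarrow> (gen, complex) falg) \<Rightarrow> ('a, complex) qmod \<Rightarrow> lweight \<Rightarrow>
   ('a \<Rightarrow>\<^sub>0 complex) set" where
  "lweight_space X \<theta> M \<Phi> = {v \<in> space M. \<forall>i\<in>idx X. \<forall>r. \<exists>N.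
     ((\<lambda>w. ev M (\<theta> (PhP i (int r))) w - vscale (fps_nth (\<Phi> i) r) w) ^^ N) v = 0}"

text \<open>The coefficient of \<open>m\<close> in the normalized \<open>q\<close>-character of a module of highest \<open>\<ell>\<close>-weight \<open>\<Psi>\<close>.\<close>

definition norm_qchar ::
  "cartan \<Rightarrow> (dgen \<Rightarrow> (gen, complex) falg) \<Rightarrow> ('a, complex) qmod \<Rightarrow> lweight \<Rightarrow> lweight \<Rightarrow> nat" where
  "norm_qchar X \<theta> M \<Psi> m = vector_space.dim vscale (lweight_space X \<theta> M (lw_mult \<Psi> m))"

text \<open>The data attached to one module: the \<open>\<ell>\<close>-weights \<open>\<Psi>\<^sub>k\<close>, the modules \<open>V\<^sub>k = L\<^sub>q(\<Psi>\<^sub>k)\<close> with highest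
  \<open>\<ell>\<close>-weight vectors, the modules \<open>L\<^sub>q(\<Psi>\<^sub>l \<Psi>\<^sub>k\<^sup>-\<^sup>1)\<close> with highest \<open>\<ell>\<close>-weight vectors, and the
  morphisms from \<open>V\<^sub>k \<otimes> L\<^sub>q(\<Psi>\<^sub>l \<Psi>\<^sub>k\<^sup>-\<^sup>1)\<close> to \<open>V\<^sub>l\<close> (index order: \<open>l\<close>, \<open>k\<close>).\<close>

record approx =
  alw :: "nat \<Rightarrow> lweight"
  amod :: "nat \<Rightarrow> (nat, complex) qmod"
  avec :: "nat \<Rightarrow> (nat \<Rightarrow>\<^sub>0 complex)"
  qmd :: "nat \<Rightarrow> nat \<Rightarrow> (nat, complex) qmod"
  qvec :: "nat \<Rightarrow> nat \<Rightarrow> (nat \<Rightarrow>\<^sub>0 complex)"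
  proj :: "nat \<Rightarrow> nat \<Rightarrow> (nat \<times> nat \<Rightarrow>\<^sub>0 complex) \<Rightarrow> (nat \<Rightarrow>\<^sub>0 complex)"

definition approximates ::
  "cartan \<Rightarrow> complex \<Rightarrow> (dgen \<Rightarrow> (gen, complex) falg) \<Rightarrow> lweight \<Rightarrow> ('a, complex) qmod \<Rightarrow>
   approx \<Rightarrow> bool" where
  "approximates X q \<theta> \<Psi> V D \<longleftrightarrow>
     (\<forall>k\<ge>1. fd_simple X q \<theta> (alw D k) (amod D k) (avec D k)) \<and>
     (\<forall>k\<ge>1. \<forall>l\<ge>k.
        fd_simple X q \<theta> (lw_mult (alw D l) (lw_inv (alw D k))) (qmd D l k) (qvec D l k) \<and>
        module_map (letters_g X) (tensor (amod D k) (qmd D l k)) (amod D l) (proj D l k) \<and>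
        proj D l k (tens (avec D k) (qvec D l k)) = avec D l) \<and>
     (\<forall>m\<in>monomials {lw_inv (A_lw X q i a) | i a. i \<in> idx X \<and> a \<noteq> 0}.
        \<forall>\<^sub>F k in sequentially.
          norm_qchar X \<theta> (amod D k) (alw D k) m = norm_qchar X \<theta> V \<Psi> m)"

text \<open>The maps \<open>G\<^sub>l\<^sub>,\<^sub>k(u)\<close> and \<open>G'\<^sub>l\<^sub>,\<^sub>k(u)\<close>: tensor with \<open>v0 \<otimes> w0\<close>, apply \<open>S\<close> to the two middle
  factors, and then \<open>p \<otimes> p'\<close>.\<close>

definition stable_map ::
  "(('a \<times> 'c \<Rightarrow>\<^sub>0 complex) \<Rightarrow> ('e \<Rightarrow>\<^sub>0 complex)) \<Rightarrow> (('b \<times> 'd \<Rightarrow>\<^sub>0 complex) \<Rightarrow> ('f \<Rightarrow>\<^sub>0 complex)) \<Rightarrow>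
   (('b \<times> 'c \<Rightarrow>\<^sub>0 ratfun) \<Rightarrow> ('c \<times> 'b \<Rightarrow>\<^sub>0 ratfun)) \<Rightarrow> ('c \<Rightarrow>\<^sub>0 complex) \<Rightarrow> ('d \<Rightarrow>\<^sub>0 complex) \<Rightarrow>
   ('a \<times> 'b \<Rightarrow>\<^sub>0 ratfun) \<Rightarrow> ('e \<times> 'f \<Rightarrow>\<^sub>0 ratfun)" where
  "stable_map p p' S v0 w0 x =
     tens_map (extend_map p) (extend_map p')
       (on_middle S (tens x (tens (extend_vec v0) (extend_vec w0))))"

definition inductive_system ::
  "(nat \<Rightarrow> ('a, ratfun) qmod) \<Rightarrow>
   (nat \<Rightarrow> nat \<Rightarrow> ('a \<Rightarrow>\<^sub>0 ratfun) \<Rightarrow> ('a \<Rightarrow>\<^sub>0 ratfun)) \<Rightarrow> bool" where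
  "inductive_system Mk G \<longleftrightarrow>
     (\<forall>k\<ge>1. \<forall>l\<ge>k. linear_map (space (Mk k)) (space (Mk l)) (G l k)) \<and>
     (\<forall>k\<ge>1. \<forall>x\<in>space (Mk k). G k k x = x) \<and>
     (\<forall>k\<ge>1. \<forall>l\<ge>k. \<forall>m\<ge>l. \<forall>x\<in>space (Mk k). G m l (G l k x) = G m k x)"

text \<open>The canonical maps \<open>Ginf k\<close> exhibit \<open>M\<close> as the limit of the system.\<close>

definition direct_limit ::
  "(nat \<Rightarrow> ('a, ratfun) qmod) \<Rightarrow> (nat \<Rightarrow> nat \<Rightarrow> ('a \<Rightarrow>\<^sub>0 ratfun) \<Rightarrow> ('a \<Rightarrow>\<^sub>0 ratfun)) \<Rightarrow>
   ('b, ratfun) qmod \<Rightarrow> (nat \<Rightarrow> ('a \<Rightarrow>\<^sub>0 ratfun) \<Rightarrow> ('b \<Rightarrow>\<^sub>0 ratfun)) \<Rightarrow> bool" where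
  "direct_limit Mk G M Ginf \<longleftrightarrow>
     (\<forall>k\<ge>1. linear_map (space (Mk k)) (space M) (Ginf k)) \<and>
     (\<forall>k\<ge>1. \<forall>l\<ge>k. \<forall>x\<in>space (Mk k). Ginf l (G l k x) = Ginf k x) \<and>
     (\<forall>y\<in>space M. \<exists>k\<ge>1. \<exists>x\<in>space (Mk k). Ginf k x = y) \<and>
     (\<forall>k\<ge>1. \<forall>x\<in>space (Mk k). Ginf k x = 0 \<longrightarrow> (\<exists>l\<ge>k. G l k x = 0))"

text \<open>
  Convergence as \<open>l\<close> tends to infinity. Matrix coefficients depend on \<open>l\<close> through a power
  \<open>t\<^sub>l\<close> of \<open>q\<^sup>-\<^sup>1\<close> whose exponent \<open>m\<^sub>l\<close> grows with the highest weights of the approximations, and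
  limits are taken by setting \<open>t\<^sub>l\<close> to \<open>0\<close>: the sequence \<open>s\<close> converges if \<open>s\<^sub>l\<close> is, for large \<open>l\<close>,
  the value at \<open>t\<^sub>l\<close> of a rational function over \<open>\<complex>(u)\<close> that is regular at \<open>0\<close>, and its limit is
  the value at \<open>0\<close>. The limit is unique as \<open>q\<close> is not a root of unity; no assumption on the
  modulus of \<open>q\<close> is needed, and for modulus greater than one it is the analytic limit.
\<close>

definition scalar_lim :: "complex \<Rightarrow> (nat \<Rightarrow> nat) \<Rightarrow> (nat \<Rightarrow> ratfun) \<Rightarrow> ratfun \<Rightarrow> bool" where
  "scalar_lim q m s c \<longleftrightarrow>
     (\<exists>P D :: ratfun poly. coeff D 0 = 1 \<and> coeff P 0 = c \<and>
        (\<forall>\<^sub>F l in sequentially. poly D (cu (inverse q ^ m l)) * s l = poly P (cu (inverse q ^ m l))))"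

text \<open>Convergence of vectors takes place in a subspace of finite dimension.\<close>

definition vec_lim ::
  "complex \<Rightarrow> (nat \<Rightarrow> nat) \<Rightarrow> (nat \<Rightarrow> ('a \<Rightarrow>\<^sub>0 ratfun)) \<Rightarrow> ('a \<Rightarrow>\<^sub>0 ratfun) \<Rightarrow> bool" where
  "vec_lim q m s v \<longleftrightarrow>
     (\<exists>S. finite S \<and> (\<forall>\<^sub>F l in sequentially. Poly_Mapping.keys (s l) \<subseteq> S)) \<and>
     (\<forall>a. scalar_lim q m (\<lambda>l. Poly_Mapping.lookup (s l) a) (Poly_Mapping.lookup v a))"

text \<open>
  The action of \<open>e\<^sub>0, \<dots>, e\<^sub>n\<close> on \<open>M\<close> is the limit of their actions on the modules of the system, and
  the action of \<open>k\<^sub>i\<close> on the image of the \<open>k\<close>-th module is the given one rescaled by \<open>\<kappa> k i\<close>.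
\<close>

definition limit_action ::
  "cartan \<Rightarrow> complex \<Rightarrow> (nat \<Rightarrow> nat) \<Rightarrow> (nat \<Rightarrow> nat \<Rightarrow> complex) \<Rightarrow> (nat \<Rightarrow> ('a, ratfun) qmod) \<Rightarrow>
   (nat \<Rightarrow> nat \<Rightarrow> ('a \<Rightarrow>\<^sub>0 ratfun) \<Rightarrow> ('a \<Rightarrow>\<^sub>0 ratfun)) \<Rightarrow>
   ('b, ratfun) qmod \<Rightarrow> (nat \<Rightarrow> ('a \<Rightarrow>\<^sub>0 ratfun) \<Rightarrow> ('b \<Rightarrow>\<^sub>0 ratfun)) \<Rightarrow> bool" where
  "limit_action X q m \<kappa> Mk G M Ginf \<longleftrightarrow>
     (\<forall>k\<ge>1. \<forall>x\<in>space (Mk k). \<forall>i\<le>rk X.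
        vec_lim q m (\<lambda>l. Ginf l (act (Mk l) (E i) (G l k x))) (act M (E i) (Ginf k x))) \<and>
     (\<forall>k\<ge>1. \<forall>x\<in>space (Mk k). \<forall>i\<in>idx X.
        act M (K i) (Ginf k x) = vscale (cu (\<kappa> k i)) (Ginf k (act (Mk k) (K i) x)))"


section \<open>Affine \<open>R\<close>-matrices\<close>

text \<open>
  \<open>R\<close> is the affine \<open>R\<close>-matrix of the simple objects \<open>V\<close>, \<open>W\<close> of \<open>\<O>\<^sup>-\<^sub>q\<close>. Here \<open>D\<close>, \<open>D'\<close> are
  approximations of \<open>V\<close>, \<open>W\<close>, \<open>RR k\<close> is the rational \<open>R\<close>-matrix of \<open>V\<^sub>k\<close> and \<open>W\<^sub>k\<close>, and \<open>RL l k\<close>,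
  \<open>RL' l k\<close> are the rational \<open>R\<close>-matrices entering the maps \<open>G\<^sub>l\<^sub>,\<^sub>k(u)\<close> and \<open>G'\<^sub>l\<^sub>,\<^sub>k(u)\<close>. The canonical
  maps take values in \<open>V(u) \<otimes> W\<close> and \<open>W \<otimes> V(u)\<close> by means of the isomorphisms of the limits
  with these modules, normalized on highest \<open>\<ell>\<close>-weight vectors. In \<open>G'\<close>, the inverse of the
  rational \<open>R\<close>-matrix from \<open>L \<otimes> V\<^sub>k(u)\<close> to \<open>V\<^sub>k(u) \<otimes> L\<close> is the one from \<open>V\<^sub>k(u) \<otimes> L\<close> to
  \<open>L \<otimes> V\<^sub>k(u)\<close>. The \<open>RR k\<close> form a morphism of inductive systems, and \<open>R\<close> is its limit. Linearity
  over the Borel algebra and bijectivity of \<open>R\<close> are consequences and not part of the definition.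
\<close>

definition affine_R_matrix ::
  "cartan \<Rightarrow> complex \<Rightarrow> (dgen \<Rightarrow> (gen, complex) falg) \<Rightarrow> ('a, complex) qmod \<Rightarrow> ('b, complex) qmod \<Rightarrow>
   (('a \<times> 'b \<Rightarrow>\<^sub>0 ratfun) \<Rightarrow> ('b \<times> 'a \<Rightarrow>\<^sub>0 ratfun)) \<Rightarrow> bool" where
  "affine_R_matrix X q \<theta> V W R \<longleftrightarrow>
     in_O_minus X q \<theta> V \<and> simple_module X V \<and> in_O_minus X q \<theta> W \<and> simple_module X W \<and>
     (\<exists>\<Psi> v \<Psi>' w D D' RR RL RL' m Ginf Ginf'.
        is_L X q \<theta> \<Psi> V v \<and> is_L X q \<theta> \<Psi>' W w \<and>
        approximates X q \<theta> \<Psi> V D \<and> approximates X q \<theta> \<Psi>' W D' \<and>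
        (\<forall>k\<ge>1. rational_R X (amod D k) (avec D k) (amod D' k) (avec D' k) (RR k)) \<and>
        (\<forall>k\<ge>1. \<forall>l\<ge>k.
           rational_R X (qmd D l k) (qvec D l k) (amod D' k) (avec D' k) (RL l k) \<and>
           rational_R X (amod D k) (avec D k) (qmd D' l k) (qvec D' l k) (RL' l k)) \<and>
        strict_mono (m :: nat \<Rightarrow> nat) \<and>
        (let Mk = (\<lambda>k. tensor (spectral uu (amod D k)) (ext_scal (amod D' k)));
             Mk' = (\<lambda>k. tensor (ext_scal (amod D' k)) (spectral uu (amod D k)));
             M = tensor (spectral uu V) (ext_scal W);
             M' = tensor (ext_scal W) (spectral uu V);
             G = (\<lambda>l k. stable_map (proj D l k) (proj D' l k)
                   (inv_into (space (tensor (spectral uu (qmd D l k)) (ext_scal (amod D' k)))) (RL l k))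
                   (qvec D l k) (qvec D' l k));
             G' = (\<lambda>l k. stable_map (proj D' l k) (proj D l k) (RL' l k) (qvec D' l k) (qvec D l k));
             \<kappa> = (\<lambda>k i. fps_nth (\<Psi> i) 0 * fps_nth (\<Psi>' i) 0 /
                   (fps_nth (alw D k i) 0 * fps_nth (alw D' k i) 0))
         in inductive_system Mk G \<and> inductive_system Mk' G' \<and>
            direct_limit Mk G M Ginf \<and> direct_limit Mk' G' M' Ginf' \<and>
            limit_action X q m \<kappa> Mk G M Ginf \<and> limit_action X q m \<kappa> Mk' G' M' Ginf' \<and>
            (\<forall>k\<ge>1. Ginf k (tens (extend_vec (avec D k)) (extend_vec (avec D' k))) =
                      tens (extend_vec v) (extend_vec w) \<and>
                    Ginf' k (tens (extend_vec (avec D' k)) (extend_vec (avec D k))) =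
                      tens (extend_vec w) (extend_vec v)) \<and>
            (\<forall>k\<ge>1. \<forall>l\<ge>k. \<forall>x\<in>space (Mk k). RR l (G l k x) = G' l k (RR k x)) \<and>
            (\<forall>k\<ge>1. \<forall>x\<in>space (Mk k). R (Ginf k x) = Ginf' k (RR k x))))"

end

theory Submission
  imports Defs
begin

text \<open>
  The isomorphism \<open>\<sigma>\<close> between the quantum loop algebras for \<open>q\<close> and \<open>q\<^sup>-\<^sup>1\<close> is an antimorphism of
  coalgebras up to an invertible factor: \<open>(k\<^sub>i\<^sup>-\<^sup>1 \<otimes> k\<^sub>i\<^sup>-\<^sup>1) \<Delta>(e\<^sub>i)\<close> becomes, after the flip, minus the
  image of \<open>\<Delta>(e\<^sub>i)\<close> under \<open>\<sigma> \<otimes> \<sigma>\<close>. Hence the flip exchanges the tensor product of two modules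
  with the tensor product, in the opposite order, of their pullbacks along \<open>\<sigma>\<close>
  (\<open>flip_transport\<close>), and conjugation by flips turns a morphism between tensor products of
  pullbacks into a morphism between tensor products of the original modules
  (\<open>b_iso_flip_at_u_inv\<close>). The affine \<open>R\<close>-matrix \<open>R'(u)\<close> has its spectral parameter on \<open>W\<close>, so
  the flip is combined with the automorphism \<open>u \<mapsto> u\<^sup>-\<^sup>1\<close> of the ground field; the result lives
  on \<open>V \<otimes> W(u\<^sup>-\<^sup>1)\<close>, and pulling back by \<open>\<tau>\<^sub>u\<close> (\<open>b_iso_shift\<close>) yields a morphism on \<open>V(u) \<otimes> W\<close>.

  It remains to see that \<open>R'(u)\<close> itself is an isomorphism of modules over the Borel subalgebra
  (\<open>affine_R_matrix_b_iso\<close>), which its definition as the limit of rational \<open>R\<close>-matrices does not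
  assert. Linearity and bijectivity pass to the limit (\<open>direct_limit_iso\<close>). The \<open>e\<^sub>i\<close> act on the
  limit as limits of their actions on the finite-dimensional modules; linear maps preserve such
  limits (\<open>vec_lim_linear\<close>), and the limits are unique because \<open>q\<close> is not a root of unity
  (\<open>vec_lim_unique\<close>), so \<open>R'(u)\<close> commutes with the \<open>e\<^sub>i\<close>. It commutes with \<open>k\<^sub>1, \<dots>, k\<^sub>n\<close> by
  construction, and then with \<open>k\<^sub>0\<close> because \<open>a\<^sub>0 = 1\<close> makes \<open>k\<^sub>0\<^sup>-\<^sup>1\<close> a product of these.

  Identities between operators on tensor products are verified on vectors \<open>v \<otimes> w\<close> with \<open>v\<close> and \<open>w\<close>
  defined over the complex numbers, where the spectral parameters enter only as scalar factors.
\<close>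


section \<open>Linear algebra over a basis\<close>

lemma lookup_lin_ext:
  assumes "finite A" "Poly_Mapping.keys v \<subseteq> A"
  shows "Poly_Mapping.lookup (lin_ext f v) x =
    (\<Sum>a\<in>A. Poly_Mapping.lookup v a * Poly_Mapping.lookup (f a) x)"
proof -
  have "Poly_Mapping.lookup (lin_ext f v) x =
      (\<Sum>a\<in>Poly_Mapping.keys v. Poly_Mapping.lookup v a * Poly_Mapping.lookup (f a) x)"
    by (simp add: lin_ext_def lookup_sum lookup_vscale)
  also have "\<dots> = (\<Sum>a\<in>A. Poly_Mapping.lookup v a * Poly_Mapping.lookup (f a) x)"
    using assms by (intro sum.mono_neutral_left) (auto simp: in_keys_iff)
  finally show ?thesis .
qed

lemmas lookup_lin_ext_keys = lookup_lin_ext[OF finite_keys order_refl]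

lemma keys_vscale: "Poly_Mapping.keys (vscale c v) \<subseteq> Poly_Mapping.keys v"
  by (auto simp: in_keys_iff lookup_vscale)

lemma lin_ext_add: "lin_ext f (v + w) = lin_ext f v + lin_ext f w"
proof (rule poly_mapping_eqI)
  fix x
  let ?A = "Poly_Mapping.keys v \<union> Poly_Mapping.keys w"
  have A: "finite ?A" "Poly_Mapping.keys (v + w) \<subseteq> ?A"
    using keys_add[of v w] by auto
  show "Poly_Mapping.lookup (lin_ext f (v + w)) x = Poly_Mapping.lookup (lin_ext f v + lin_ext f w) x"
    by (simp add: lookup_lin_ext[OF A] lookup_lin_ext[of ?A] lookup_add distrib_right sum.distrib)
qed

lemma lin_ext_vscale: "lin_ext f (vscale c v) = vscale c (lin_ext f v)"
  by (rule poly_mapping_eqI, subst lookup_lin_ext[OF finite_keys keys_vscale])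
    (simp add: lookup_lin_ext_keys lookup_vscale sum_distrib_left mult.assoc)

lemma vscale_simps [simp]:
  "vscale c 0 = 0" "vscale 0 v = 0" "vscale 1 v = v" "vscale c (vscale d v) = vscale (c * d) v"
  "vscale (- c) v = - vscale c v" "vscale c (- v) = - vscale c v"
  by (auto intro!: poly_mapping_eqI simp: lookup_vscale)

lemma vscale_add: "vscale c (v + w) = vscale c v + vscale c w"
  by (auto intro!: poly_mapping_eqI simp: lookup_vscale lookup_add distrib_left)

lemma lin_ext_single: "lin_ext f (Poly_Mapping.single a c) = vscale c (f a)"
  by (auto simp: lin_ext_def)

lemma lin_ext_basis_vec [simp]: "lin_ext f (basis_vec a) = f a"
  by (simp add: basis_vec_def lin_ext_single)

lemma lin_ext_basis_id: "lin_ext basis_vec v = v"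
  by (rule poly_mapping_eqI)
    (simp add: lookup_lin_ext_keys basis_vec_def lookup_single when_def in_keys_iff
      if_distrib[where f = "(*) _"] cong: if_cong)

lemma lin_ext_uminus: "lin_ext f (- v) = - lin_ext f v"
  using lin_ext_vscale[of f "-1" v] by simp

lemma lin_ext_diff: "lin_ext f (v - w) = lin_ext f v - lin_ext f w"
  using lin_ext_add[of f v "- w"] by (simp add: lin_ext_uminus)

lemma lin_ext_fun_add: "lin_ext (\<lambda>a. f a + g a) v = lin_ext f v + lin_ext g v"
  by (rule poly_mapping_eqI)
    (simp add: lookup_lin_ext_keys lookup_add distrib_left sum.distrib)

lemma lin_ext_zero [simp]: "lin_ext f 0 = 0"
  by (simp add: lin_ext_def)

lemma vecs_on_closed [simp]:
  "0 \<in> vecs_on B" "v \<in> vecs_on B \<Longrightarrow> w \<in> vecs_on B \<Longrightarrow> v + w \<in> vecs_on B"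
  "v \<in> vecs_on B \<Longrightarrow> vscale c v \<in> vecs_on B" "v \<in> vecs_on B \<Longrightarrow> - v \<in> vecs_on B"
  "a \<in> B \<Longrightarrow> basis_vec a \<in> vecs_on B"
  using keys_add[of v w] keys_vscale[of c v]
  by (auto simp: vecs_on_def basis_vec_def)

lemma space_closed [simp]:
  "0 \<in> space M" "v \<in> space M \<Longrightarrow> w \<in> space M \<Longrightarrow> v + w \<in> space M"
  "v \<in> space M \<Longrightarrow> vscale c v \<in> space M" "v \<in> space M \<Longrightarrow> - v \<in> space M"
  "a \<in> basis M \<Longrightarrow> basis_vec a \<in> space M"
  by (auto simp: space_def)

lemma vecs_on_sum: "(\<And>a. a \<in> A \<Longrightarrow> f a \<in> vecs_on B) \<Longrightarrow> sum f A \<in> vecs_on B"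
  by (induction A rule: infinite_finite_induct) auto

lemma lin_ext_in_vecs_on:
  assumes "\<And>a. a \<in> A \<Longrightarrow> f a \<in> vecs_on B" and "v \<in> vecs_on A"
  shows "lin_ext f v \<in> vecs_on B"
  unfolding lin_ext_def using assms by (intro vecs_on_sum vecs_on_closed) (auto simp: vecs_on_def)

lemma linear_map_lin_ext:
  "(\<And>a. a \<in> A \<Longrightarrow> f a \<in> vecs_on B) \<Longrightarrow> linear_map (vecs_on A) (vecs_on B) (lin_ext f)"
  by (auto simp: linear_map_def lin_ext_add lin_ext_vscale intro!: lin_ext_in_vecs_on[of A])

text \<open>Agreement on a basis determines a semilinear map; the map \<open>s\<close> records how scalars are
  twisted, so that one principle covers linear maps and maps that invert the spectral parameter.\<close>

lemma semilinear_eqI: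
  fixes f g :: "('a \<Rightarrow>\<^sub>0 'k::field) \<Rightarrow> ('b \<Rightarrow>\<^sub>0 'k)"
  assumes add: "\<And>v w. v \<in> vecs_on B \<Longrightarrow> w \<in> vecs_on B \<Longrightarrow> f (v + w) = f v + f w"
      "\<And>v w. v \<in> vecs_on B \<Longrightarrow> w \<in> vecs_on B \<Longrightarrow> g (v + w) = g v + g w"
    and scale: "\<And>c v. v \<in> vecs_on B \<Longrightarrow> f (vscale c v) = vscale (s c) (f v)"
      "\<And>c v. v \<in> vecs_on B \<Longrightarrow> g (vscale c v) = vscale (s c) (g v)"
    and basis: "\<And>b. b \<in> B \<Longrightarrow> f (basis_vec b) = g (basis_vec b)"
    and v: "v \<in> vecs_on B"
  shows "f v = g v"
proof -
  have z: "f 0 = 0" "g 0 = 0"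
    using add(1)[of 0 0] add(2)[of 0 0] by auto
  have "finite A \<Longrightarrow> A \<subseteq> B \<Longrightarrow>
      (\<Sum>a\<in>A. vscale (c a) (basis_vec a)) \<in> vecs_on B \<and>
      f (\<Sum>a\<in>A. vscale (c a) (basis_vec a)) = g (\<Sum>a\<in>A. vscale (c a) (basis_vec a))" for A c
    by (induction A rule: finite_induct) (auto simp: z add scale basis)
  from this[of "Poly_Mapping.keys v" "Poly_Mapping.lookup v"] v lin_ext_basis_id[of v]
  show ?thesis
    by (simp add: lin_ext_def vecs_on_def)
qed

lemma linear_map_eqI:
  assumes "linear_map (vecs_on B) T f" "linear_map (vecs_on B) T' g"
    and "\<And>b. b \<in> B \<Longrightarrow> f (basis_vec b) = g (basis_vec b)" "v \<in> vecs_on B"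
  shows "f v = g v"
  by (rule semilinear_eqI[where B = B and s = id]) (use assms in \<open>auto simp: linear_map_def\<close>)

lemma linear_map_conv_lin_ext:
  assumes "linear_map (vecs_on B) T f" "v \<in> vecs_on B"
  shows "f v = lin_ext (\<lambda>a. f (basis_vec a)) v"
  by (rule linear_map_eqI[OF assms(1) linear_map_lin_ext _ assms(2)]) (auto simp: vecs_on_def)

lemma linear_map_zero: "linear_map (space M) T f \<Longrightarrow> f 0 = 0"
  unfolding linear_map_def by (metis space_closed(1) vscale_simps(2))

lemma linear_map_uminus: "linear_map (space M) T f \<Longrightarrow> v \<in> space M \<Longrightarrow> f (- v) = - f v"
  unfolding linear_map_def by (metis vscale_simps(3,5))

lemma linear_map_sum:
  assumes f: "linear_map (space M) T f" and g: "\<And>a. a \<in> A \<Longrightarrow> g a \<in> space M"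
  shows "f (sum g A) = (\<Sum>a\<in>A. f (g a))"
proof -
  have "(\<And>a. a \<in> A \<Longrightarrow> g a \<in> space M) \<Longrightarrow> sum g A \<in> space M \<and> f (sum g A) = (\<Sum>a\<in>A. f (g a))"
    using f by (induction A rule: infinite_finite_induct) (auto simp: linear_map_zero linear_map_def)
  with g show ?thesis by blast
qed

lemma lookup_tens:
  "Poly_Mapping.lookup (tens v w) (a, b) = Poly_Mapping.lookup v a * Poly_Mapping.lookup w b"
proof -
  have "(\<Sum>y\<in>Poly_Mapping.keys w. Poly_Mapping.lookup v x * Poly_Mapping.lookup w y when (x, y) = (a, b))
      = (Poly_Mapping.lookup v x * Poly_Mapping.lookup w b when x = a)" for x
    by (auto simp: when_def in_keys_iff sum.delta)
  then show ?thesis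
    by (auto simp: tens_def lookup_sum lookup_single when_def in_keys_iff sum.delta)
qed

lemma tens_simps:
  "tens (v + v') w = tens v w + tens v' w" "tens v (w + w') = tens v w + tens v w'"
  "tens (vscale c v) w = vscale c (tens v w)" "tens v (vscale c w) = vscale c (tens v w)"
  "tens (- v) w = - tens v w" "tens v (- w) = - tens v w"
  by (rule poly_mapping_eqI, clarify,
      simp add: lookup_tens lookup_add lookup_vscale distrib_left distrib_right mult_ac)+

lemma tens_basis_vec: "tens (basis_vec a) (basis_vec b) = basis_vec (a, b)"
  by (rule poly_mapping_eqI, clarify)
    (simp add: lookup_tens basis_vec_def lookup_single when_def)

lemma tens_in_vecs_on: "v \<in> vecs_on A \<Longrightarrow> w \<in> vecs_on B \<Longrightarrow> tens v w \<in> vecs_on (A \<times> B)"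
  unfolding vecs_on_def subset_iff by (force simp: in_keys_iff lookup_tens)

lemma lin_ext_tens:
  "lin_ext (\<lambda>(a, b). tens (f a) (g b)) (tens v w) = tens (lin_ext f v) (lin_ext g w)"
proof (rule poly_mapping_eqI, clarify)
  fix x y
  have k: "Poly_Mapping.keys (tens v w) \<subseteq> Poly_Mapping.keys v \<times> Poly_Mapping.keys w"
    by (auto simp: in_keys_iff lookup_tens)
  have t: "Poly_Mapping.lookup (tens v w) p =
      Poly_Mapping.lookup v (fst p) * Poly_Mapping.lookup w (snd p)" for p
    by (metis lookup_tens prod.collapse)
  show "Poly_Mapping.lookup (lin_ext (\<lambda>(a, b). tens (f a) (g b)) (tens v w)) (x, y) =
      Poly_Mapping.lookup (tens (lin_ext f v) (lin_ext g w)) (x, y)"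
    by (subst lookup_lin_ext[OF _ k])
      (simp_all add: lookup_tens t lookup_lin_ext_keys sum_product
        sum.cartesian_product case_prod_unfold mult_ac)
qed

lemma lookup_flip: "Poly_Mapping.lookup (flip v) (b, a) = Poly_Mapping.lookup v (a, b)"
proof -
  have "Poly_Mapping.lookup (flip v) (b, a) =
      (\<Sum>x\<in>Poly_Mapping.keys v. if x = (a, b) then Poly_Mapping.lookup v x else 0)"
    unfolding flip_def lookup_lin_ext_keys
    by (rule sum.cong) (auto simp: basis_vec_def lookup_single when_def split: if_splits)
  then show ?thesis by (simp add: in_keys_iff)
qed

lemma flip_simps:
  "flip (v + w) = flip v + flip w" "flip (vscale c v) = vscale c (flip v)"
  "flip (flip v) = v" "flip (tens x y) = tens y x"
  by (rule poly_mapping_eqI, clarify,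
      simp add: lookup_tens lookup_add lookup_vscale lookup_flip mult.commute)+

lemma flip_in_vecs_on: "v \<in> vecs_on (A \<times> B) \<Longrightarrow> flip v \<in> vecs_on (B \<times> A)"
  unfolding vecs_on_def subset_iff by (force simp: in_keys_iff lookup_flip)


section \<open>The automorphism inverting the spectral parameter\<close>

lemma cu_simps [simp]:
  "cu 0 = 0" "cu 1 = 1" "cu (a + b) = cu a + cu b" "cu (a * b) = cu a * cu b"
  "cu (- a) = - cu a" "cu a = 0 \<longleftrightarrow> a = 0"
proof -
  show "cu 1 = 1"
    unfolding cu_def one_pCons[symmetric] by simp
qed (simp_all add: cu_def flip: to_fract_add to_fract_mult to_fract_uminus)

lemma cu_sum: "cu (sum f A) = (\<Sum>a\<in>A. cu (f a))"
  by (induction A rule: infinite_finite_induct) auto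

lemma cu_eq_iff [simp]: "cu a = cu b \<longleftrightarrow> a = b"
  by (simp add: cu_def)

lemma uu_nonzero [simp]: "uu \<noteq> 0"
  by (simp add: uu_def)

definition at_inverse_uu :: "complex poly \<Rightarrow> ratfun" where
  "at_inverse_uu p = poly (map_poly cu p) (inverse uu)"

lemma at_inverse_uu_0 [simp]: "at_inverse_uu 0 = 0"
  by (simp add: at_inverse_uu_def)

lemma at_inverse_uu_pCons: "at_inverse_uu (pCons a p) = cu a + inverse uu * at_inverse_uu p"
  by (simp add: at_inverse_uu_def map_poly_pCons)

lemma at_inverse_uu_1 [simp]: "at_inverse_uu 1 = 1"
  by (simp add: at_inverse_uu_pCons one_pCons)

lemma at_inverse_uu_add: "at_inverse_uu (p + r) = at_inverse_uu p + at_inverse_uu r"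
  by (induction p r rule: poly_induct2) (simp_all add: at_inverse_uu_pCons algebra_simps)

lemma at_inverse_uu_smult: "at_inverse_uu (smult c p) = cu c * at_inverse_uu p"
  by (induction p) (simp_all add: at_inverse_uu_pCons algebra_simps)

lemma at_inverse_uu_mult: "at_inverse_uu (p * r) = at_inverse_uu p * at_inverse_uu r"
  by (induction p)
    (simp_all add: at_inverse_uu_pCons at_inverse_uu_add at_inverse_uu_smult algebra_simps)

lemma to_fract_pCons: "to_fract (pCons a p) = cu a + uu * to_fract p"
  by (simp add: cu_def uu_def flip: to_fract_add to_fract_mult)

lemma poly_map_cu_uu: "poly (map_poly cu p) uu = to_fract p"
  by (induction p) (simp_all add: map_poly_pCons to_fract_pCons)

text \<open>Up to a power of \<open>u\<close>, the value of \<open>p\<close> at \<open>u\<^sup>-\<^sup>1\<close> is the reflected polynomial of \<open>p\<close>, so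
  \<open>u\<^sup>-\<^sup>1\<close> is transcendental and the substitution extends to fractions.\<close>

lemma at_inverse_uu_eq_0_iff [simp]: "at_inverse_uu p = 0 \<longleftrightarrow> p = 0"
proof
  assume 0: "at_inverse_uu p = 0"
  have "reflect_poly (map_poly cu p) = map_poly cu (reflect_poly p)"
    by (rule poly_eqI) (simp add: coeff_reflect_poly coeff_map_poly degree_map_poly)
  then have "to_fract (reflect_poly p) = poly (reflect_poly (map_poly cu p)) uu"
    by (simp add: poly_map_cu_uu)
  also have "\<dots> = 0"
    using 0 poly_reflect_poly_nz[of "inverse uu" "map_poly cu p"] poly_reflect_poly_nz[of uu "map_poly cu p"]
    by (simp add: at_inverse_uu_def)
  finally show "p = 0" by simp
qed simp

lemma subst_u_inv_Fract:
  assumes "r \<noteq> 0"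
  shows "subst_u_inv (Fract p r) = at_inverse_uu p / at_inverse_uu r"
  unfolding subst_u_inv_def
proof (rule the_equality)
  show "\<exists>p' r'. r' \<noteq> 0 \<and> Fract p r = Fract p' r' \<and> at_inverse_uu p / at_inverse_uu r =
      poly (map_poly cu p') (inverse uu) / poly (map_poly cu r') (inverse uu)"
    using assms by (auto simp: at_inverse_uu_def)
next
  fix y
  assume "\<exists>p' r'. r' \<noteq> 0 \<and> Fract p r = Fract p' r' \<and>
      y = poly (map_poly cu p') (inverse uu) / poly (map_poly cu r') (inverse uu)"
  then obtain p' r' where *: "r' \<noteq> 0" "Fract p r = Fract p' r'"
      "y = at_inverse_uu p' / at_inverse_uu r'"
    by (auto simp: at_inverse_uu_def)
  with assms have "p * r' = p' * r" by (simp add: eq_fract)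
  then have "at_inverse_uu p * at_inverse_uu r' = at_inverse_uu p' * at_inverse_uu r"
    by (simp flip: at_inverse_uu_mult)
  with * assms show "y = at_inverse_uu p / at_inverse_uu r"
    by (simp add: frac_eq_eq)
qed

lemma subst_u_inv_to_fract: "subst_u_inv (to_fract p) = at_inverse_uu p"
  by (simp add: to_fract_def subst_u_inv_Fract)

lemma subst_u_inv_add: "subst_u_inv (x + y) = subst_u_inv x + subst_u_inv y"
proof (cases x; cases y)
  fix a b c d :: "complex poly"
  assume [simp]: "x = Fract a b" "b \<noteq> 0" "y = Fract c d" "d \<noteq> 0"
  have "subst_u_inv (x + y) = (at_inverse_uu a * at_inverse_uu d + at_inverse_uu c * at_inverse_uu b) /
      (at_inverse_uu b * at_inverse_uu d)"
    by (simp add: subst_u_inv_Fract at_inverse_uu_add at_inverse_uu_mult)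
  also have "\<dots> = subst_u_inv x + subst_u_inv y"
    by (simp add: subst_u_inv_Fract add_frac_eq)
  finally show ?thesis .
qed

lemma subst_u_inv_mult: "subst_u_inv (x * y) = subst_u_inv x * subst_u_inv y"
proof (cases x; cases y)
  fix a b c d :: "complex poly"
  assume [simp]: "x = Fract a b" "b \<noteq> 0" "y = Fract c d" "d \<noteq> 0"
  show ?thesis
    by (simp add: subst_u_inv_Fract at_inverse_uu_mult)
qed

lemma subst_u_inv_cu [simp]: "subst_u_inv (cu c) = cu c"
  by (simp add: cu_def subst_u_inv_to_fract at_inverse_uu_pCons)

lemma subst_u_inv_0 [simp]: "subst_u_inv 0 = 0"
  using subst_u_inv_cu[of 0] by simp

lemma subst_u_inv_1 [simp]: "subst_u_inv 1 = 1"
  using subst_u_inv_cu[of 1] by simp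

lemma subst_u_inv_uu [simp]: "subst_u_inv uu = inverse uu"
  by (simp add: uu_def subst_u_inv_to_fract at_inverse_uu_pCons)

lemma subst_u_inv_inverse: "subst_u_inv (inverse x) = inverse (subst_u_inv x)"
proof (cases "x = 0")
  case False
  then have "subst_u_inv x * subst_u_inv (inverse x) = 1"
    by (simp flip: subst_u_inv_mult)
  then show ?thesis by (metis inverse_unique)
qed simp

lemma subst_u_inv_idem [simp]: "subst_u_inv (subst_u_inv x) = x"
proof -
  have *: "subst_u_inv (at_inverse_uu p) = to_fract p" for p
    by (induction p)
      (simp_all add: at_inverse_uu_pCons subst_u_inv_add subst_u_inv_mult subst_u_inv_inverse to_fract_pCons)
  obtain p r where x: "x = Fract p r" "r \<noteq> 0"
    by (cases x)
  then have "subst_u_inv (subst_u_inv x) =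
      subst_u_inv (at_inverse_uu p) * inverse (subst_u_inv (at_inverse_uu r))"
    by (simp only: subst_u_inv_Fract divide_inverse subst_u_inv_mult subst_u_inv_inverse simp_thms)
  also have "\<dots> = x"
    by (simp only: * x Fract_conv_to_fract divide_inverse)
  finally show ?thesis .
qed

lemma lookup_subst_vec: "Poly_Mapping.lookup (subst_vec v) a = subst_u_inv (Poly_Mapping.lookup v a)"
  by (simp add: subst_vec_def Poly_Mapping.map.rep_eq when_def)

lemma lookup_extend_vec: "Poly_Mapping.lookup (extend_vec v) a = cu (Poly_Mapping.lookup v a)"
  by (simp add: extend_vec_def Poly_Mapping.map.rep_eq when_def)

lemma subst_vec_simps:
  "subst_vec (v + w) = subst_vec v + subst_vec w"
  "subst_vec (vscale c v) = vscale (subst_u_inv c) (subst_vec v)"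
  "subst_vec (subst_vec v) = v"
  by (rule poly_mapping_eqI,
      simp add: lookup_subst_vec lookup_add lookup_vscale subst_u_inv_add subst_u_inv_mult)+

lemma subst_vec_flip: "subst_vec (flip v) = flip (subst_vec v)"
  by (rule poly_mapping_eqI, clarify) (simp add: lookup_subst_vec lookup_flip)

lemma subst_vec_pure: "subst_vec (tens (extend_vec v) (extend_vec w)) = tens (extend_vec v) (extend_vec w)"
  by (rule poly_mapping_eqI, clarify)
    (simp add: lookup_subst_vec lookup_tens lookup_extend_vec subst_u_inv_mult)

lemma subst_vec_in_vecs_on: "v \<in> vecs_on A \<Longrightarrow> subst_vec v \<in> vecs_on A"
proof -
  have "Poly_Mapping.keys (subst_vec v) \<subseteq> Poly_Mapping.keys v"
  proof
    fix a assume "a \<in> Poly_Mapping.keys (subst_vec v)"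
    then show "a \<in> Poly_Mapping.keys v"
      by (cases "Poly_Mapping.lookup v a = 0") (simp_all add: in_keys_iff lookup_subst_vec)
  qed
  then show "v \<in> vecs_on A \<Longrightarrow> subst_vec v \<in> vecs_on A"
    by (auto simp: vecs_on_def)
qed


section \<open>Extension of scalars and tensor products\<close>

lemma extend_vec_simps [simp]:
  "extend_vec (v + w) = extend_vec v + extend_vec w" "extend_vec (- v) = - extend_vec v"
  "extend_vec 0 = 0" "extend_vec (vscale c v) = vscale (cu c) (extend_vec v)"
  "extend_vec (basis_vec a) = basis_vec a"
  by (rule poly_mapping_eqI, simp add: lookup_extend_vec lookup_add lookup_vscale basis_vec_def
      lookup_single when_def)+

lemma keys_extend_vec [simp]: "Poly_Mapping.keys (extend_vec v) = Poly_Mapping.keys v"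
  by (auto simp: in_keys_iff lookup_extend_vec)

lemma extend_vec_in_vecs_on [simp]: "extend_vec v \<in> vecs_on A \<longleftrightarrow> v \<in> vecs_on A"
  by (simp add: vecs_on_def)

lemma extend_map_extend_vec:
  assumes "linear_map (space M) T f" "v \<in> space M"
  shows "extend_map f (extend_vec v) = extend_vec (f v)"
proof (rule poly_mapping_eqI)
  fix x
  have "f v = lin_ext (\<lambda>a. f (basis_vec a)) v"
    using assms unfolding space_def by (rule linear_map_conv_lin_ext)
  then show "Poly_Mapping.lookup (extend_map f (extend_vec v)) x =
      Poly_Mapping.lookup (extend_vec (f v)) x"
    by (simp add: extend_map_def lookup_lin_ext_keys lookup_extend_vec cu_sum)
qed

lemma ev_conv_lin_ext: "ev M x v = lin_ext (\<lambda>w. word_act M w v) x"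
  by (simp add: ev_def lin_ext_def)

lemma ev_simps [simp]:
  "ev M (lett g) v = act M g v" "ev M 1 v = v"
  "ev M (scal c * lett g) v = vscale c (act M g v)"
  "ev M (lett g * lett h) v = act M g (act M h v)"
  "ev M (- x) v = - ev M x v" "ev M (x - y) v = ev M x v - ev M y v"
  by (simp_all add: ev_conv_lin_ext lett_def scal_def mult_single lin_ext_single lin_ext_uminus
      lin_ext_diff word_act_def plus_fmonoid_def zero_fmonoid_def flip: single_one)

lemma act_spectral:
  "act (spectral t M) g v = vscale (t powi gen_deg g) (extend_map (act M g) v)"
  by (cases g) (simp_all add: spectral_def pullback_def ext_scal_def power_int_minus)

lemma basis_simps [simp]:
  "basis (spectral t M) = basis M" "basis (ext_scal M) = basis M"
  "basis (functor_F M) = basis M"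
  "basis (tensor P Q) = basis P \<times> basis Q"
  by (simp_all add: spectral_def pullback_def ext_scal_def tensor_def functor_F_def)

lemma ext_scal_conv_spectral: "ext_scal M = spectral 1 M"
proof -
  have "act (ext_scal M) = act (spectral 1 M)"
    by (intro ext) (simp add: act_spectral, simp add: ext_scal_def)
  then show ?thesis
    by (intro qmod.equality) simp_all
qed

lemma linear_b_module: "b_module X q M \<Longrightarrow> g \<in> letters_b X \<Longrightarrow> linear_map (space M) (space M) (act M g)"
  by (simp add: b_module_def)

lemma act_in_space: "b_module X q M \<Longrightarrow> g \<in> letters_b X \<Longrightarrow> v \<in> space M \<Longrightarrow> act M g v \<in> space M"
  using linear_b_module[of X q M g] by (simp add: linear_map_def)

lemma letters_b_mem [simp]:
  "E i \<in> letters_b X \<longleftrightarrow> i \<le> rk X" "K i \<in> letters_b X \<longleftrightarrow> i \<le> rk X" "Kinv i \<in> letters_b X \<longleftrightarrow> i \<le> rk X"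
  "F i \<notin> letters_b X"
  by (auto simp: letters_b_def)

lemma lin_ext_fun_vscale: "lin_ext (\<lambda>a. vscale c (f a)) v = vscale c (lin_ext f v)"
  by (rule poly_mapping_eqI)
    (simp add: lookup_lin_ext_keys lookup_vscale sum_distrib_left mult_ac)

lemma lin_ext_act_spectral:
  "lin_ext (\<lambda>a. act (spectral t M) g (basis_vec a)) v = act (spectral t M) g v"
  by (simp add: act_spectral extend_map_def lin_ext_fun_vscale)

lemma linear_map_tensor:
  assumes "b_module X q P" "b_module X q' Q" "g \<in> letters_b X"
  shows "linear_map (space (tensor (spectral s P) (spectral t Q)))
      (space (tensor (spectral s P) (spectral t Q))) (act (tensor (spectral s P) (spectral t Q)) g)"
proof -
  have cl: "act (spectral r M) g (basis_vec a) \<in> vecs_on (basis M)"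
    if "b_module X p M" "g \<in> letters_b X" "a \<in> basis M" for r p g a and M :: "('e, complex) qmod"
    using act_in_space[OF that(1,2), of "basis_vec a"] that(3)
    by (simp add: act_spectral extend_map_def space_def)
  show ?thesis
    unfolding space_def
    by (cases g; use assms in \<open>simp add: tensor_def\<close>)
      (intro linear_map_lin_ext; use assms in \<open>auto intro!: vecs_on_closed tens_in_vecs_on intro: cl\<close>)+
qed

text \<open>The action on a tensor product of modules with spectral parameters is computed on the vectors
  \<open>v \<otimes> w\<close> with \<open>v\<close> and \<open>w\<close> defined over \<open>\<complex>\<close>, which include the basis.\<close>

lemma act_tensor_E:
  assumes "b_module X q P" "b_module X q' Q" "i \<le> rk X" "v \<in> space P" "w \<in> space Q"
  shows "act (tensor (spectral s P) (spectral t Q)) (E i) (tens (extend_vec v) (extend_vec w)) =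
    vscale (s powi gen_deg (E i)) (tens (extend_vec (act P (E i) v)) (extend_vec w)) +
    vscale (t powi gen_deg (E i)) (tens (extend_vec (act P (K i) v)) (extend_vec (act Q (E i) w)))"
proof -
  let ?P = "spectral s P" and ?Q = "spectral t Q"
  have "act (tensor ?P ?Q) (E i) x =
      lin_ext (\<lambda>(a, b). tens (act ?P (E i) (basis_vec a)) (basis_vec b)) x +
      lin_ext (\<lambda>(a, b). tens (act ?P (K i) (basis_vec a)) (act ?Q (E i) (basis_vec b))) x" for x
    by (simp add: tensor_def case_prod_unfold flip: lin_ext_fun_add)
  then show ?thesis
    using assms
    by (simp add: lin_ext_tens lin_ext_act_spectral lin_ext_basis_id)
      (simp add: act_spectral tens_simps extend_map_extend_vec[OF linear_b_module])
qed

lemma act_tensor_K: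
  assumes "b_module X q P" "b_module X q' Q" "g = K i \<or> g = Kinv i" "i \<le> rk X"
    and "v \<in> space P" "w \<in> space Q"
  shows "act (tensor (spectral s P) (spectral t Q)) g (tens (extend_vec v) (extend_vec w)) =
    tens (extend_vec (act P g v)) (extend_vec (act Q g w))"
proof -
  have "act (tensor (spectral s P) (spectral t Q)) g x =
      lin_ext (\<lambda>(a, b). tens (act (spectral s P) g (basis_vec a)) (act (spectral t Q) g (basis_vec b))) x" for x
    using assms(3) by (auto simp: tensor_def)
  then show ?thesis
    using assms
    by (simp add: lin_ext_tens lin_ext_act_spectral)
      (auto simp: act_spectral extend_map_extend_vec[OF linear_b_module])
qed

lemma pure_in_space:
  "v \<in> space P \<Longrightarrow> w \<in> space Q \<Longrightarrow>
    tens (extend_vec v) (extend_vec w) \<in> space (tensor (spectral s P) (spectral t Q))"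
  by (simp add: space_def tens_in_vecs_on)

lemma semilinear_tensor_eqI:
  fixes f g :: "('a \<times> 'b \<Rightarrow>\<^sub>0 ratfun) \<Rightarrow> ('c \<Rightarrow>\<^sub>0 ratfun)"
  assumes "\<And>v w. v \<in> space (tensor (spectral s P) (spectral t Q)) \<Longrightarrow>
        w \<in> space (tensor (spectral s P) (spectral t Q)) \<Longrightarrow> f (v + w) = f v + f w"
      "\<And>v w. v \<in> space (tensor (spectral s P) (spectral t Q)) \<Longrightarrow>
        w \<in> space (tensor (spectral s P) (spectral t Q)) \<Longrightarrow> g (v + w) = g v + g w"
    and "\<And>c v. v \<in> space (tensor (spectral s P) (spectral t Q)) \<Longrightarrow> f (vscale c v) = vscale (\<gamma> c) (f v)"
      "\<And>c v. v \<in> space (tensor (spectral s P) (spectral t Q)) \<Longrightarrow> g (vscale c v) = vscale (\<gamma> c) (g v)"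
    and basis: "\<And>v w. v \<in> space P \<Longrightarrow> w \<in> space Q \<Longrightarrow>
        f (tens (extend_vec v) (extend_vec w)) = g (tens (extend_vec v) (extend_vec w))"
    and "x \<in> space (tensor (spectral s P) (spectral t Q))"
  shows "f x = g x"
proof (rule semilinear_eqI[where B = "basis P \<times> basis Q" and s = \<gamma>])
  show "f (basis_vec p) = g (basis_vec p)" if "p \<in> basis P \<times> basis Q" for p
    using that basis[of "basis_vec (fst p)" "basis_vec (snd p)"]
    by (auto simp: tens_basis_vec)
qed (use assms in \<open>auto simp: space_def\<close>)

lemma linear_tensor_eqI:
  assumes "linear_map (space (tensor (spectral s P) (spectral t Q))) T f"
    "linear_map (space (tensor (spectral s P) (spectral t Q))) T' g"
    and "\<And>v w. v \<in> space P \<Longrightarrow> w \<in> space Q \<Longrightarrow>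
        f (tens (extend_vec v) (extend_vec w)) = g (tens (extend_vec v) (extend_vec w))"
    and "x \<in> space (tensor (spectral s P) (spectral t Q))"
  shows "f x = g x"
  by (rule semilinear_tensor_eqI[where \<gamma> = id and s = s and t = t and P = P and Q = Q])
    (use assms in \<open>auto simp: linear_map_def\<close>)


section \<open>Borel-linear maps between tensor products\<close>

lemma module_mapI:
  assumes f: "linear_map (space M) (space N) f"
    and cl: "\<And>g v. g \<in> S \<Longrightarrow> v \<in> space M \<Longrightarrow> act M g v \<in> space M"
    and comm: "\<And>g v. g \<in> S \<Longrightarrow> v \<in> space M \<Longrightarrow> f (act M g v) = act N g (f v)"
  shows "module_map S M N f"
proof -
  have w: "foldr (act M) ws v \<in> space M \<and> f (foldr (act M) ws v) = foldr (act N) ws (f v)"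
    if "set ws \<subseteq> S" "v \<in> space M" for ws v
    using that by (induction ws) (auto simp: cl comm)
  have "f (ev M x v) = ev N x (f v)" if x: "x \<in> falg_on S" and v: "v \<in> space M" for x v
  proof -
    have *: "word_act M w v \<in> space M \<and> f (word_act M w v) = word_act N w (f v)"
      if "w \<in> Poly_Mapping.keys x" for w
      unfolding word_act_def using that x v by (intro w) (auto simp: falg_on_def)
    then have "f (ev M x v) =
        (\<Sum>w\<in>Poly_Mapping.keys x. f (vscale (Poly_Mapping.lookup x w) (word_act M w v)))"
      unfolding ev_def by (intro linear_map_sum[OF f]) simp
    also have "\<dots> = ev N x (f v)"
      unfolding ev_def using * f by (intro sum.cong) (auto simp: linear_map_def)
    finally show ?thesis .
  qed
  with f show ?thesis by (simp add: module_map_def)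
qed

lemma lett_in_falg_on: "g \<in> S \<Longrightarrow> lett g \<in> falg_on S"
  by (simp add: falg_on_def lett_def)

lemma module_map_act:
  assumes "module_map S M N f" "g \<in> S" "v \<in> space M"
  shows "f (act M g v) = act N g (f v)"
proof -
  have "f (ev M (lett g) v) = ev N (lett g) (f v)"
    using assms lett_in_falg_on[of g S] unfolding module_map_def by blast
  then show ?thesis by simp
qed

lemma uq_rels_subset_ideal: "uq_rels X q \<subseteq> uq_ideal X q"
proof
  fix x assume "x \<in> uq_rels X q"
  moreover have "1 \<in> falg_on (letters_g X)"
    by (simp add: falg_on_def zero_fmonoid_def)
  ultimately have "1 * x * 1 \<in> uq_ideal X q"
    unfolding uq_ideal_def by (intro ideal_gen.gen)
  then show "x \<in> uq_ideal X q" by simp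
qed

lemma letters_b_subset_g: "letters_b X \<subseteq> letters_g X"
  by (auto simp: letters_b_def letters_g_def)

lemma g_module_imp_b_module: "g_module X q M \<Longrightarrow> b_module X q M"
  using letters_b_subset_g[of X] by (auto simp: g_module_def b_module_def)

lemma word_minus_1_in_falg_on:
  "set ws \<subseteq> S \<Longrightarrow> Poly_Mapping.single (Monom ws) (1::'k::field) - 1 \<in> falg_on S"
proof -
  assume "set ws \<subseteq> S"
  moreover have "Poly_Mapping.keys (Poly_Mapping.single (Monom ws) (1::'k) - 1) \<subseteq> {Monom ws, Monom []}"
    using keys_diff[of "Poly_Mapping.single (Monom ws) (1::'k)" 1] by (auto simp: zero_fmonoid_def)
  ultimately show ?thesis
    by (fastforce simp: falg_on_def)
qed

text \<open>Relations equating a product of generators with \<open>1\<close>, as those among the \<open>k\<^sub>i\<^sup>\<plusminus>\<^sup>1\<close>.\<close>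

lemma word_relation:
  assumes "b_module X q M" "Poly_Mapping.single (Monom ws) 1 - 1 \<in> uq_rels X q"
    and "set ws \<subseteq> letters_b X" "v \<in> space M"
  shows "foldr (act M) ws v = v"
proof -
  have "ev M (Poly_Mapping.single (Monom ws) 1 - 1) v = 0"
    using assms uq_rels_subset_ideal word_minus_1_in_falg_on unfolding b_module_def by blast
  then show ?thesis
    by (simp add: ev_conv_lin_ext lin_ext_diff lin_ext_single word_act_def zero_fmonoid_def
        flip: single_one)
qed

lemma lett_mult_eq: "lett g * lett h = Poly_Mapping.single (Monom [g, h]) 1"
  by (simp add: lett_def mult_single plus_fmonoid_def)

lemma K_Kinv:
  assumes "b_module X q M" "i \<le> rk X" "v \<in> space M"
  shows "act M (K i) (act M (Kinv i) v) = v" "act M (Kinv i) (act M (K i) v) = v"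
proof -
  have "Poly_Mapping.single (Monom [K i, Kinv i]) 1 - 1 \<in> uq_rels X q"
      "Poly_Mapping.single (Monom [Kinv i, K i]) 1 - 1 \<in> uq_rels X q"
    unfolding uq_rels_def lett_mult_eq using assms(2) by blast+
  from this[THEN word_relation[OF assms(1)]] assms
  show "act M (K i) (act M (Kinv i) v) = v" "act M (Kinv i) (act M (K i) v) = v"
    by simp_all
qed

lemma linear_map_comp:
  "linear_map S T f \<Longrightarrow> linear_map T U g \<Longrightarrow> linear_map S U (\<lambda>v. g (f v))"
  by (simp add: linear_map_def)

lemma linear_map_id: "linear_map S S (\<lambda>v. v)"
  by (simp add: linear_map_def)

lemma linear_map_foldr:
  "(\<And>g. g \<in> set gs \<Longrightarrow> linear_map S S (A g)) \<Longrightarrow> linear_map S S (foldr A gs)"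
proof (induction gs)
  case Nil
  show ?case by (simp add: linear_map_def)
next
  case (Cons g gs)
  have "linear_map S S (\<lambda>v. A g (foldr A gs v))"
    by (rule linear_map_comp[of S S]) (rule Cons.IH Cons.prems; simp add: Cons.prems)+
  then show ?case by (simp add: comp_def)
qed

definition K_word :: "cartan \<Rightarrow> gen list" where
  "K_word X = concat (map (\<lambda>i. replicate (aa X i) (K i)) [1..<Suc (rk X)])"

lemma set_K_word: "set (K_word X) \<subseteq> K ` idx X"
  by (auto simp: K_word_def idx_def)

text \<open>Since \<open>a\<^sub>0 = 1\<close>, the relation \<open>k\<^sub>0\<^bsup>a\<^sub>0\<^esup> \<cdots> k\<^sub>n\<^bsup>a\<^sub>n\<^esup> = 1\<close> expresses \<open>k\<^sub>0\<^sup>-\<^sup>1\<close> through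
  \<open>k\<^sub>1, \<dots>, k\<^sub>n\<close>.\<close>

lemma Kinv_0_act:
  assumes "aa X 0 = 1" "b_module X q M" "v \<in> space M"
  shows "act M (Kinv 0) v = foldr (act M) (K_word X) v"
proof -
  have pow: "lett g ^ n = Poly_Mapping.single (Monom (replicate n g)) 1" for g n
    by (induction n) (simp_all add: lett_def mult_single plus_fmonoid_def zero_fmonoid_def
        flip: single_one)
  have "prod_list (map (\<lambda>i. lett (K i) ^ aa X i) is) =
      Poly_Mapping.single (Monom (concat (map (\<lambda>i. replicate (aa X i) (K i)) is))) 1" for "is"
    by (induction "is") (simp_all add: pow mult_single plus_fmonoid_def zero_fmonoid_def
        flip: single_one)
  moreover have "concat (map (\<lambda>i. replicate (aa X i) (K i)) [0..<Suc (rk X)]) = K 0 # K_word X"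
    using assms(1) by (simp add: K_word_def upt_conv_Cons del: upt_Suc)
  moreover have "prod_list (map (\<lambda>i. lett (K i) ^ aa X i) [0..<Suc (rk X)]) - 1 \<in> uq_rels X q"
    unfolding uq_rels_def by blast
  ultimately have "Poly_Mapping.single (Monom (K 0 # K_word X)) 1 - 1 \<in> uq_rels X q"
    by metis
  moreover have sub: "set (K_word X) \<subseteq> letters_b X"
    using set_K_word[of X] by (auto simp: idx_def)
  ultimately have "act M (K 0) (foldr (act M) (K_word X) v) = v"
    using word_relation[OF assms(2), of "K 0 # K_word X" v] assms(3) by simp
  moreover have "foldr (act M) (K_word X) v \<in> space M"
    using linear_map_foldr[of "K_word X" "space M" "act M"] sub assms(3) linear_b_module[OF assms(2)]
    unfolding linear_map_def by blast
  ultimately show ?thesis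
    using K_Kinv(2)[OF assms(2), of 0] by fastforce
qed

lemma K_Kinv_tensor:
  fixes P :: "('a, complex) qmod" and Q :: "('b, complex) qmod" and s t :: ratfun
  assumes P: "b_module X q P" and Q: "b_module X q Q" and i: "i \<le> rk X"
  defines "T \<equiv> tensor (spectral s P) (spectral t Q)"
  assumes x: "x \<in> space T"
  shows "act T (K i) (act T (Kinv i) x) = x" "act T (Kinv i) (act T (K i) x) = x"
proof -
  have lin: "linear_map (space T) (space T) (act T (K i))"
    "linear_map (space T) (space T) (act T (Kinv i))"
    unfolding T_def using i by (intro linear_map_tensor[OF P Q]; simp)+
  note simps = i act_tensor_K[OF P Q] act_in_space[OF P] act_in_space[OF Q] K_Kinv[OF P] K_Kinv[OF Q]
  show "act T (K i) (act T (Kinv i) x) = x"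
    by (rule linear_tensor_eqI[OF linear_map_comp[OF lin(2,1)[unfolded T_def]] linear_map_id _
          x[unfolded T_def], folded T_def])
      (simp add: T_def simps)
  show "act T (Kinv i) (act T (K i) x) = x"
    by (rule linear_tensor_eqI[OF linear_map_comp[OF lin[unfolded T_def]] linear_map_id _
          x[unfolded T_def], folded T_def])
      (simp add: T_def simps)
qed

lemma Kinv_0_act_tensor:
  fixes P :: "('a, complex) qmod" and Q :: "('b, complex) qmod" and s t :: ratfun
  assumes a: "aa X 0 = 1" and P: "b_module X q P" and Q: "b_module X q Q"
  defines "T \<equiv> tensor (spectral s P) (spectral t Q)"
  assumes x: "x \<in> space T"
  shows "act T (Kinv 0) x = foldr (act T) (K_word X) x"
proof -
  have sub: "set (K_word X) \<subseteq> letters_b X"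
    using set_K_word[of X] by (auto simp: idx_def)
  have lin: "g \<in> letters_b X \<Longrightarrow> linear_map (space T) (space T) (act T g)" for g
    unfolding T_def by (rule linear_map_tensor[OF P Q])
  have "foldr (act P) gs v \<in> space P \<and> foldr (act Q) gs w \<in> space Q \<and>
      foldr (act T) gs (tens (extend_vec v) (extend_vec w)) =
      tens (extend_vec (foldr (act P) gs v)) (extend_vec (foldr (act Q) gs w))"
    if "set gs \<subseteq> K ` idx X" "v \<in> space P" "w \<in> space Q" for gs v w
    using that
    by (induction gs)
      (auto simp: T_def act_tensor_K[OF P Q] idx_def act_in_space[OF P] act_in_space[OF Q])
  then have "act T (Kinv 0) (tens (extend_vec v) (extend_vec w)) =
      foldr (act T) (K_word X) (tens (extend_vec v) (extend_vec w))"
    if "v \<in> space P" "w \<in> space Q" for v w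
    using that set_K_word[of X]
    by (simp add: T_def act_tensor_K[OF P Q] Kinv_0_act[OF a P] Kinv_0_act[OF a Q])
  moreover have "linear_map (space T) (space T) (foldr (act T) (K_word X))"
    using sub lin by (intro linear_map_foldr) auto
  moreover have "linear_map (space T) (space T) (act T (Kinv 0))"
    by (intro lin) simp
  ultimately show ?thesis
    using linear_tensor_eqI[OF _ _ _ x[unfolded T_def], folded T_def] by blast
qed

text \<open>The relations determine the operators of \<open>k\<^sub>0\<close> and of the inverses \<open>k\<^sub>i\<^sup>-\<^sup>1\<close> from those of
  \<open>k\<^sub>1, \<dots>, k\<^sub>n\<close>. This matters because the limit construction prescribes only the latter.\<close>

lemma module_map_tensorI:
  fixes P :: "('a, complex) qmod" and Q :: "('b, complex) qmod"
    and P' :: "('c, complex) qmod" and Q' :: "('d, complex) qmod"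
    and s t s' t' :: ratfun
  defines "T \<equiv> tensor (spectral s P) (spectral t Q)"
    and "T' \<equiv> tensor (spectral s' P') (spectral t' Q')"
  assumes a: "aa X 0 = 1"
    and P: "b_module X q P" "b_module X q Q" and P': "b_module X q' P'" "b_module X q' Q'"
    and f: "linear_map (space T) (space T') f"
    and E: "\<And>i x. i \<le> rk X \<Longrightarrow> x \<in> space T \<Longrightarrow> f (act T (E i) x) = act T' (E i) (f x)"
    and K: "\<And>i x. i \<in> idx X \<Longrightarrow> x \<in> space T \<Longrightarrow> f (act T (K i) x) = act T' (K i) (f x)"
  shows "module_map (letters_b X) T T' f"
proof (rule module_mapI[OF f])
  show cl: "act T g x \<in> space T" if "g \<in> letters_b X" "x \<in> space T" for g x
    using linear_map_tensor[OF P that(1)] that(2) unfolding T_def linear_map_def by blast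
  have cl': "act T' g x \<in> space T'" if "g \<in> letters_b X" "x \<in> space T'" for g x
    using linear_map_tensor[OF P' that(1)] that(2) unfolding T'_def linear_map_def by blast
  have f': "x \<in> space T \<Longrightarrow> f x \<in> space T'" for x
    using f by (simp add: linear_map_def)
  note inv = K_Kinv_tensor[OF P, where s = s and t = t, folded T_def]
    and inv' = K_Kinv_tensor[OF P', where s = s' and t = t', folded T'_def]
  have "foldr (act T) gs x \<in> space T \<and> f (foldr (act T) gs x) = foldr (act T') gs (f x)"
    if "set gs \<subseteq> K ` idx X" "x \<in> space T" for gs x
    using that
  proof (induction gs)
    case (Cons g gs)
    then obtain i where i: "g = K i" "i \<in> idx X" "i \<le> rk X"
      by (auto simp: idx_def)
    with Cons show ?case by (simp add: K cl)
  qed simp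
  then have Ki0: "f (act T (Kinv 0) x) = act T' (Kinv 0) (f x)" if "x \<in> space T" for x
    using that set_K_word[of X] Kinv_0_act_tensor[OF a P, where s = s and t = t, folded T_def, OF that]
      Kinv_0_act_tensor[OF a P', where s = s' and t = t', folded T'_def, OF f'[OF that]] by presburger
  have "f (act T (K 0) x) = act T' (K 0) (f x)" if x: "x \<in> space T" for x
  proof -
    have "act T' (Kinv 0) (f (act T (K 0) x)) = f x"
      using Ki0[of "act T (K 0) x"] x by (simp add: cl inv)
    then show ?thesis
      using inv'(1)[of 0 "f (act T (K 0) x)"] x by (simp add: cl f')
  qed
  then have K': "f (act T (K i) x) = act T' (K i) (f x)" if "i \<le> rk X" "x \<in> space T" for i x
    using that K[of i] by (cases "i = 0") (auto simp: idx_def)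
  have "f (act T (Kinv i) x) = act T' (Kinv i) (f x)" if i: "i \<le> rk X" and x: "x \<in> space T" for i x
  proof -
    have "act T' (K i) (f (act T (Kinv i) x)) = f x"
      using K'[OF i, of "act T (Kinv i) x"] x i by (simp add: cl inv)
    then show ?thesis
      using inv'(2)[OF i, of "f (act T (Kinv i) x)"] i x by (simp add: cl f')
  qed
  note Kinv = this
  show "f (act T g x) = act T' g (f x)" if "g \<in> letters_b X" "x \<in> space T" for g x
    using that by (cases g) (simp_all add: E K' Kinv)
qed


section \<open>Limits in the sense of rational functions of \<open>q\<^sup>-\<^sup>m\<close>\<close>

lemma powers_inject:
  fixes q :: complex
  assumes "q \<noteq> 0" "\<forall>m\<ge>1. q ^ m \<noteq> 1" "q ^ a = q ^ b"
  shows "a = b"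
proof -
  have False if "a < b" "q ^ a = q ^ b" for a b
  proof -
    have "q ^ b = q ^ a * q ^ (b - a)"
      using that(1) by (simp flip: power_add)
    then have "q ^ (b - a) = 1"
      using that assms(1) by simp
    with assms(2) that(1) show False by simp
  qed
  then show ?thesis
    using assms(3) by (metis nat_neq_iff)
qed

text \<open>A polynomial is determined by its values at the pairwise distinct points \<open>q\<^sup>-\<^sup>m\<close>.\<close>

lemma poly_eqI_eventually:
  assumes q: "q \<noteq> 0" "\<forall>n\<ge>1. q ^ n \<noteq> 1" and m: "strict_mono m"
    and ev: "\<forall>\<^sub>F l in sequentially. poly P (cu (inverse q ^ m l)) = poly Q (cu (inverse q ^ m l))"
  shows "P = Q"
proof (rule ccontr)
  assume "P \<noteq> Q"
  then have fin: "finite {x. poly (P - Q) x = 0}"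
    by (intro poly_roots_finite) simp
  obtain N where N: "\<And>l. l \<ge> N \<Longrightarrow> poly P (cu (inverse q ^ m l)) = poly Q (cu (inverse q ^ m l))"
    using ev by (auto simp: eventually_sequentially)
  have inj: "inj (\<lambda>l. cu (inverse q ^ m l))"
  proof (rule injI)
    fix a b assume "cu (inverse q ^ m a) = cu (inverse q ^ m b)"
    then have "inverse q ^ m a = inverse q ^ m b"
      by (simp only: cu_eq_iff)
    then have "q ^ m a = q ^ m b"
      by (simp add: power_inverse)
    then have "m a = m b"
      by (rule powers_inject[OF q])
    then show "a = b"
      using m by (simp add: strict_mono_eq)
  qed
  have "(\<lambda>l. cu (inverse q ^ m l)) ` {N..} \<subseteq> {x. poly (P - Q) x = 0}"
    using N by auto
  then have "finite ((\<lambda>l. cu (inverse q ^ m l)) ` {N..})"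
    using fin finite_subset by blast
  then have "finite {N..}"
    using inj by (meson finite_imageD inj_on_subset subset_UNIV)
  then show False
    using infinite_Ici by blast
qed

text \<open>If \<open>P / D\<close> and \<open>P' / D'\<close> both interpolate the sequence, then \<open>D' P\<close> and \<open>D P'\<close> agree at
  infinitely many points, hence are equal; compare the constant terms.\<close>

lemma scalar_lim_unique:
  assumes q: "q \<noteq> 0" "\<forall>n\<ge>1. q ^ n \<noteq> 1" "strict_mono m"
    and c: "scalar_lim q m s c" and d: "scalar_lim q m s d"
  shows "c = d"
proof -
  obtain P D where PD: "coeff D 0 = 1" "coeff P 0 = c"
      "\<forall>\<^sub>F l in sequentially. poly D (cu (inverse q ^ m l)) * s l = poly P (cu (inverse q ^ m l))"
    using c unfolding scalar_lim_def by blast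
  obtain P' D' where PD': "coeff D' 0 = 1" "coeff P' 0 = d"
      "\<forall>\<^sub>F l in sequentially. poly D' (cu (inverse q ^ m l)) * s l = poly P' (cu (inverse q ^ m l))"
    using d unfolding scalar_lim_def by blast
  have "\<forall>\<^sub>F l in sequentially.
      poly (D' * P) (cu (inverse q ^ m l)) = poly (D * P') (cu (inverse q ^ m l))"
    using PD(3) PD'(3)
  proof eventually_elim
    case (elim l)
    show ?case
      unfolding poly_mult elim[symmetric] by (simp only: mult.left_commute)
  qed
  then have "D' * P = D * P'"
    by (rule poly_eqI_eventually[OF q])
  then have "coeff (D' * P) 0 = coeff (D * P') 0" by simp
  then show "c = d"
    using PD(1,2) PD'(1,2) by (simp add: coeff_mult)
qed

lemma scalar_lim_cong:
  assumes "\<forall>\<^sub>F l in sequentially. s l = s' l" "scalar_lim q m s c"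
  shows "scalar_lim q m s' c"
proof -
  obtain P D where PD: "coeff D 0 = 1" "coeff P 0 = c"
      "\<forall>\<^sub>F l in sequentially. poly D (cu (inverse q ^ m l)) * s l = poly P (cu (inverse q ^ m l))"
    using assms(2) unfolding scalar_lim_def by blast
  from assms(1) PD(3)
  have "\<forall>\<^sub>F l in sequentially. poly D (cu (inverse q ^ m l)) * s' l = poly P (cu (inverse q ^ m l))"
    by eventually_elim simp
  with PD(1,2) show ?thesis unfolding scalar_lim_def by blast
qed

lemma scalar_lim_zero: "scalar_lim q m (\<lambda>l. 0) 0"
  unfolding scalar_lim_def by (intro exI[of _ 0] exI[of _ 1]) simp

lemma scalar_lim_cmult:
  assumes "scalar_lim q m s c"
  shows "scalar_lim q m (\<lambda>l. s l * a) (c * a)"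
proof -
  obtain P D where PD: "coeff D 0 = 1" "coeff P 0 = c"
      "\<forall>\<^sub>F l in sequentially. poly D (cu (inverse q ^ m l)) * s l = poly P (cu (inverse q ^ m l))"
    using assms unfolding scalar_lim_def by blast
  have "\<forall>\<^sub>F l in sequentially.
      poly D (cu (inverse q ^ m l)) * (s l * a) = poly (smult a P) (cu (inverse q ^ m l))"
    using PD(3)
  proof eventually_elim
    case (elim l)
    show ?case unfolding poly_smult elim[symmetric] by (simp only: mult_ac)
  qed
  moreover have "coeff (smult a P) 0 = c * a"
    using PD(2) by simp
  ultimately show ?thesis
    using PD(1) unfolding scalar_lim_def by blast
qed

lemma scalar_lim_add:
  assumes "scalar_lim q m s c" "scalar_lim q m s' d"
  shows "scalar_lim q m (\<lambda>l. s l + s' l) (c + d)"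
proof -
  obtain P D where PD: "coeff D 0 = 1" "coeff P 0 = c"
      "\<forall>\<^sub>F l in sequentially. poly D (cu (inverse q ^ m l)) * s l = poly P (cu (inverse q ^ m l))"
    using assms(1) unfolding scalar_lim_def by blast
  obtain P' D' where PD': "coeff D' 0 = 1" "coeff P' 0 = d"
      "\<forall>\<^sub>F l in sequentially. poly D' (cu (inverse q ^ m l)) * s' l = poly P' (cu (inverse q ^ m l))"
    using assms(2) unfolding scalar_lim_def by blast
  have "\<forall>\<^sub>F l in sequentially. poly (D * D') (cu (inverse q ^ m l)) * (s l + s' l) =
      poly (D' * P + D * P') (cu (inverse q ^ m l))"
    using PD(3) PD'(3)
  proof eventually_elim
    case (elim l)
    show ?case
      unfolding poly_add poly_mult elim[symmetric] by (simp only: distrib_left distrib_right mult_ac)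
  qed
  moreover have "coeff (D * D') 0 = 1" "coeff (D' * P + D * P') 0 = c + d"
    using PD(1,2) PD'(1,2) by (simp_all add: coeff_mult)
  ultimately show ?thesis
    unfolding scalar_lim_def by blast
qed

lemma scalar_lim_sum:
  assumes "\<And>a. a \<in> A \<Longrightarrow> scalar_lim q m (\<lambda>l. s l a) (c a)"
  shows "scalar_lim q m (\<lambda>l. \<Sum>a\<in>A. s l a) (\<Sum>a\<in>A. c a)"
  using assms
  by (induction A rule: infinite_finite_induct) (simp_all add: scalar_lim_zero scalar_lim_add)

lemma vec_lim_unique:
  assumes "q \<noteq> 0" "\<forall>n\<ge>1. q ^ n \<noteq> 1" "strict_mono m" "vec_lim q m s v" "vec_lim q m s w"
  shows "v = w"
proof (rule poly_mapping_eqI)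
  fix a
  have "scalar_lim q m (\<lambda>l. Poly_Mapping.lookup (s l) a) (Poly_Mapping.lookup v a)"
      "scalar_lim q m (\<lambda>l. Poly_Mapping.lookup (s l) a) (Poly_Mapping.lookup w a)"
    using assms(4,5) unfolding vec_lim_def by blast+
  then show "Poly_Mapping.lookup v a = Poly_Mapping.lookup w a"
    by (rule scalar_lim_unique[OF assms(1-3)])
qed

lemma vec_lim_cong:
  assumes "\<forall>\<^sub>F l in sequentially. s l = s' l" "vec_lim q m s v"
  shows "vec_lim q m s' v"
proof -
  obtain S where S: "finite S" "\<forall>\<^sub>F l in sequentially. Poly_Mapping.keys (s l) \<subseteq> S"
    using assms(2) unfolding vec_lim_def by blast
  from assms(1) S(2) have "\<forall>\<^sub>F l in sequentially. Poly_Mapping.keys (s' l) \<subseteq> S"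
    by eventually_elim simp
  moreover have "scalar_lim q m (\<lambda>l. Poly_Mapping.lookup (s' l) a) (Poly_Mapping.lookup v a)" for a
  proof (rule scalar_lim_cong)
    show "\<forall>\<^sub>F l in sequentially. Poly_Mapping.lookup (s l) a = Poly_Mapping.lookup (s' l) a"
      using assms(1) by eventually_elim simp
  qed (use assms(2) in \<open>simp add: vec_lim_def\<close>)
  ultimately show ?thesis
    using S(1) unfolding vec_lim_def by blast
qed

text \<open>Since the vectors of a convergent sequence eventually lie in a subspace of finite dimension,
  linear maps are continuous for this notion of limit.\<close>

lemma vec_lim_linear:
  assumes q: "q \<noteq> 0" "\<forall>n\<ge>1. q ^ n \<noteq> 1" "strict_mono m"
    and lim: "vec_lim q m s v" and f: "linear_map (space M) (space N) f"
    and s: "\<forall>\<^sub>F l in sequentially. s l \<in> space M" and v: "v \<in> space M"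
  shows "vec_lim q m (\<lambda>l. f (s l)) (f v)"
proof -
  obtain S where S: "finite S" "\<forall>\<^sub>F l in sequentially. Poly_Mapping.keys (s l) \<subseteq> S"
    and sc: "\<And>a. scalar_lim q m (\<lambda>l. Poly_Mapping.lookup (s l) a) (Poly_Mapping.lookup v a)"
    using lim unfolding vec_lim_def by blast
  \<comment> \<open>A coordinate outside \<open>S\<close> is eventually \<open>0\<close>, so its limit is \<open>0\<close>.\<close>
  have kv: "Poly_Mapping.keys v \<subseteq> S"
  proof
    fix a assume a: "a \<in> Poly_Mapping.keys v"
    show "a \<in> S"
    proof (rule ccontr)
      assume "a \<notin> S"
      have "\<forall>\<^sub>F l in sequentially. Poly_Mapping.lookup (s l) a = 0"
        using S(2) by eventually_elim (use \<open>a \<notin> S\<close> in \<open>auto simp: in_keys_iff\<close>)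
      from scalar_lim_cong[OF this sc] have "Poly_Mapping.lookup v a = 0"
        using scalar_lim_unique[OF q] scalar_lim_zero by blast
      with a show False by (simp add: in_keys_iff)
    qed
  qed
  have f_lookup: "Poly_Mapping.lookup (f x) b =
      (\<Sum>a\<in>S. Poly_Mapping.lookup x a * Poly_Mapping.lookup (f (basis_vec a)) b)"
    if "x \<in> space M" "Poly_Mapping.keys x \<subseteq> S" for x b
    using linear_map_conv_lin_ext[OF f[unfolded space_def]] that lookup_lin_ext[OF S(1)]
    by (simp add: space_def)
  have ev: "\<forall>\<^sub>F l in sequentially. (\<Sum>a\<in>S. Poly_Mapping.lookup (s l) a *
      Poly_Mapping.lookup (f (basis_vec a)) b) = Poly_Mapping.lookup (f (s l)) b" for b
    using s S(2) by eventually_elim (simp add: f_lookup)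
  have "scalar_lim q m (\<lambda>l. Poly_Mapping.lookup (f (s l)) b) (Poly_Mapping.lookup (f v) b)" for b
    unfolding f_lookup[OF v kv]
    by (rule scalar_lim_cong[OF ev]) (intro scalar_lim_sum scalar_lim_cmult sc)
  moreover have "\<forall>\<^sub>F l in sequentially.
      Poly_Mapping.keys (f (s l)) \<subseteq> (\<Union>a\<in>S. Poly_Mapping.keys (f (basis_vec a)))"
    using s S(2)
  proof eventually_elim
    case (elim l)
    show ?case
    proof
      fix b assume "b \<in> Poly_Mapping.keys (f (s l))"
      then have "(\<Sum>a\<in>S. Poly_Mapping.lookup (s l) a * Poly_Mapping.lookup (f (basis_vec a)) b) \<noteq> 0"
        using f_lookup[OF elim] by (simp add: in_keys_iff)
      then obtain a where "a \<in> S"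
          "Poly_Mapping.lookup (s l) a * Poly_Mapping.lookup (f (basis_vec a)) b \<noteq> 0"
        by (rule sum.not_neutral_contains_not_neutral)
      then show "b \<in> (\<Union>a\<in>S. Poly_Mapping.keys (f (basis_vec a)))"
        by (auto simp: in_keys_iff)
    qed
  qed
  ultimately show ?thesis
    unfolding vec_lim_def using S(1)
    by (intro conjI exI[of _ "\<Union>a\<in>S. Poly_Mapping.keys (f (basis_vec a))"]) simp_all
qed


section \<open>The affine \<open>R\<close>-matrix is a morphism\<close>

text \<open>Two vectors of the limit come from a common stage, which gives linearity. Every vector of the
  target comes from some stage, where the isomorphism is surjective; a vector killed by \<open>R\<close> has
  a representative at a later stage that is killed by the isomorphism there, which is injective.\<close>

lemma direct_limit_iso:
  assumes G: "inductive_system Mk G" "direct_limit Mk G M Ginf"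
    and G': "inductive_system Mk' G'" "direct_limit Mk' G' M' Ginf'"
    and RR: "\<And>k. k \<ge> 1 \<Longrightarrow> linear_map (space (Mk k)) (space (Mk' k)) (RR k)"
      "\<And>k. k \<ge> 1 \<Longrightarrow> bij_betw (RR k) (space (Mk k)) (space (Mk' k))"
    and morph: "\<And>k l x. k \<ge> 1 \<Longrightarrow> l \<ge> k \<Longrightarrow> x \<in> space (Mk k) \<Longrightarrow> RR l (G l k x) = G' l k (RR k x)"
    and R: "\<And>k x. k \<ge> 1 \<Longrightarrow> x \<in> space (Mk k) \<Longrightarrow> R (Ginf k x) = Ginf' k (RR k x)"
  shows "linear_map (space M) (space M') R" and "bij_betw R (space M) (space M')"
proof -
  have lin: "\<And>k l. k \<ge> 1 \<Longrightarrow> l \<ge> k \<Longrightarrow> linear_map (space (Mk k)) (space (Mk l)) (G l k)"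
    "\<And>k. k \<ge> 1 \<Longrightarrow> linear_map (space (Mk k)) (space M) (Ginf k)"
    "\<And>k. k \<ge> 1 \<Longrightarrow> linear_map (space (Mk' k)) (space M') (Ginf' k)"
    using G G' unfolding inductive_system_def direct_limit_def by simp_all
  have comp: "\<And>k l x. k \<ge> 1 \<Longrightarrow> l \<ge> k \<Longrightarrow> x \<in> space (Mk k) \<Longrightarrow> Ginf l (G l k x) = Ginf k x"
    using G(2) unfolding direct_limit_def by simp
  have surj: "\<And>y. y \<in> space M \<Longrightarrow> \<exists>k\<ge>1. \<exists>x\<in>space (Mk k). Ginf k x = y"
    "\<And>y. y \<in> space M' \<Longrightarrow> \<exists>k\<ge>1. \<exists>x\<in>space (Mk' k). Ginf' k x = y"
    using G(2) G'(2) unfolding direct_limit_def by simp_all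
  have ker: "\<And>k x. k \<ge> 1 \<Longrightarrow> x \<in> space (Mk' k) \<Longrightarrow> Ginf' k x = 0 \<Longrightarrow> \<exists>l\<ge>k. G' l k x = 0"
    using G'(2) unfolding direct_limit_def by simp
  have RR_in: "RR k x \<in> space (Mk' k)" if "k \<ge> 1" "x \<in> space (Mk k)" for k x
    using RR(1)[OF that(1)] that(2) by (simp add: linear_map_def)
  have G_in: "G l k x \<in> space (Mk l)" if "k \<ge> 1" "l \<ge> k" "x \<in> space (Mk k)" for k l x
    using lin(1)[OF that(1,2)] that(3) by (simp add: linear_map_def)
  have R_in: "R y \<in> space M'" if "y \<in> space M" for y
  proof -
    obtain k x where k: "k \<ge> 1" "x \<in> space (Mk k)" "Ginf k x = y"
      using surj(1)[OF \<open>y \<in> space M\<close>] by blast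
    show ?thesis
      using R[OF k(1,2)] lin(3)[OF k(1)] RR_in[OF k(1,2)] k(3) by (simp add: linear_map_def)
  qed
  have R_add: "R (y + y') = R y + R y'" if "y \<in> space M" "y' \<in> space M" for y y'
  proof -
    obtain k x where k: "k \<ge> 1" "x \<in> space (Mk k)" "Ginf k x = y"
      using surj(1)[OF \<open>y \<in> space M\<close>] by blast
    obtain k' x' where k': "k' \<ge> 1" "x' \<in> space (Mk k')" "Ginf k' x' = y'"
      using surj(1)[OF \<open>y' \<in> space M\<close>] by blast
    define l where "l = max k k'"
    define z z' where "z = G l k x" and "z' = G l k' x'"
    have l: "l \<ge> 1" "l \<ge> k" "l \<ge> k'"
      using k(1) by (simp_all add: l_def)
    have z: "z \<in> space (Mk l)" "z' \<in> space (Mk l)" "Ginf l z = y" "Ginf l z' = y'"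
      unfolding z_def z'_def
      using G_in[OF k(1) l(2) k(2)] G_in[OF k'(1) l(3) k'(2)] comp[OF k(1) l(2) k(2)]
        comp[OF k'(1) l(3) k'(2)] k(3) k'(3) by simp_all
    have "R (y + y') = R (Ginf l (z + z'))"
      using z lin(2)[OF l(1)] by (simp add: linear_map_def)
    also have "\<dots> = Ginf' l (RR l (z + z'))"
      by (rule R[OF l(1)]) (simp add: z)
    also have "\<dots> = Ginf' l (RR l z) + Ginf' l (RR l z')"
      using z RR(1)[OF l(1)] lin(3)[OF l(1)] by (simp add: linear_map_def)
    also have "\<dots> = R y + R y'"
      using R[OF l(1) z(1)] R[OF l(1) z(2)] z by simp
    finally show ?thesis .
  qed
  have R_scale: "R (vscale c y) = vscale c (R y)" if "y \<in> space M" for c y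
  proof -
    obtain k x where k: "k \<ge> 1" "x \<in> space (Mk k)" "Ginf k x = y"
      using surj(1)[OF \<open>y \<in> space M\<close>] by blast
    have "R (vscale c y) = R (Ginf k (vscale c x))"
      using k(2,3) lin(2)[OF k(1)] by (simp add: linear_map_def)
    also have "\<dots> = Ginf' k (RR k (vscale c x))"
      by (rule R[OF k(1)]) (simp add: k)
    also have "\<dots> = vscale c (Ginf' k (RR k x))"
      using k RR(1)[OF k(1)] lin(3)[OF k(1)] by (simp add: linear_map_def)
    also have "\<dots> = vscale c (R y)"
      using R[OF k(1,2)] k(3) by simp
    finally show ?thesis .
  qed
  show linR: "linear_map (space M) (space M') R"
    unfolding linear_map_def using R_in R_add R_scale by blast
  have inj0: "y = 0" if "y \<in> space M" "R y = 0" for y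
  proof -
    obtain k x where k: "k \<ge> 1" "x \<in> space (Mk k)" "Ginf k x = y"
      using surj(1)[OF \<open>y \<in> space M\<close>] by blast
    have "Ginf' k (RR k x) = 0"
      using R[OF k(1,2)] k(3) that(2) by simp
    then obtain l where l: "l \<ge> k" "G' l k (RR k x) = 0"
      using ker[OF k(1) RR_in[OF k(1,2)]] by blast
    have l1: "l \<ge> 1" using k l by simp
    have "RR l (G l k x) = RR l 0"
      using morph[OF k(1) l(1) k(2)] l(2) linear_map_zero[OF RR(1)[OF l1]] by simp
    then have "G l k x = 0"
      by (rule inj_onD[OF bij_betw_imp_inj_on[OF RR(2)[OF l1]] _ G_in[OF k(1) l(1) k(2)] space_closed(1)])
    then show "y = 0"
      using comp[OF k(1) l(1) k(2)] k(3) linear_map_zero[OF lin(2)[OF l1]] by simp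
  qed
  have "inj_on R (space M)"
  proof (rule inj_onI)
    fix y y' assume y: "y \<in> space M" "y' \<in> space M" "R y = R y'"
    have m: "- y' \<in> space M"
      using y(2) by (rule space_closed)
    have "R (y + - y') = R y + R (- y')"
      by (rule R_add[OF y(1) m])
    also have "\<dots> = 0"
      unfolding linear_map_uminus[OF linR y(2)] y(3) by (rule right_minus)
    finally have "y + - y' = 0"
      by (rule inj0[OF space_closed(2)[OF y(1) m]])
    then show "y = y'" by simp
  qed
  moreover have "R ` space M = space M'"
  proof
    show "R ` space M \<subseteq> space M'"
      by (rule image_subsetI) (rule R_in)
    show "space M' \<subseteq> R ` space M"
    proof
      fix y' assume "y' \<in> space M'"
      from surj(2)[OF this]
      obtain k x' where k: "k \<ge> 1" "x' \<in> space (Mk' k)" "Ginf' k x' = y'"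
        by blast
      have "x' \<in> RR k ` space (Mk k)"
        using bij_betw_imp_surj_on[OF RR(2)[OF k(1)]] k(2) by simp
      then obtain x where x: "x \<in> space (Mk k)" "RR k x = x'"
        by blast
      then have "y' = R (Ginf k x)"
        using R[OF k(1) x(1)] k(3) by simp
      moreover have "Ginf k x \<in> space M"
        using lin(2)[OF k(1)] x(1) by (simp add: linear_map_def)
      ultimately show "y' \<in> R ` space M" by blast
    qed
  qed
  ultimately show "bij_betw R (space M) (space M')"
    by (simp add: bij_betw_def)
qed

text \<open>The \<open>e\<^sub>i\<close> act on the limit through limits of their actions on the modules of the system. As
  \<open>R\<close> is linear, it carries limits to limits, and uniqueness of limits makes it commute with the
  \<open>e\<^sub>i\<close>; on the \<open>k\<^sub>i\<close> both limits are rescaled by the same factor.\<close>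

lemma direct_limit_intertwines:
  assumes q: "q \<noteq> 0" "\<forall>n\<ge>1. q ^ n \<noteq> 1" "strict_mono m"
    and G: "inductive_system Mk G" "direct_limit Mk G M Ginf" "limit_action X q m \<kappa> Mk G M Ginf"
    and G': "direct_limit Mk' G' M' Ginf'" "limit_action X q m \<kappa> Mk' G' M' Ginf'"
    and RR: "\<And>k. k \<ge> 1 \<Longrightarrow> module_map (letters_b X) (Mk k) (Mk' k) (RR k)"
    and cl: "\<And>k g x. k \<ge> 1 \<Longrightarrow> g \<in> letters_b X \<Longrightarrow> x \<in> space (Mk k) \<Longrightarrow> act (Mk k) g x \<in> space (Mk k)"
    and clM: "\<And>g y. g \<in> letters_b X \<Longrightarrow> y \<in> space M \<Longrightarrow> act M g y \<in> space M"
    and morph: "\<And>k l x. k \<ge> 1 \<Longrightarrow> l \<ge> k \<Longrightarrow> x \<in> space (Mk k) \<Longrightarrow> RR l (G l k x) = G' l k (RR k x)"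
    and R: "\<And>k x. k \<ge> 1 \<Longrightarrow> x \<in> space (Mk k) \<Longrightarrow> R (Ginf k x) = Ginf' k (RR k x)"
    and linR: "linear_map (space M) (space M') R"
    and y: "y \<in> space M"
  shows "i \<le> rk X \<Longrightarrow> R (act M (E i) y) = act M' (E i) (R y)"
    and "i \<in> idx X \<Longrightarrow> R (act M (K i) y) = act M' (K i) (R y)"
proof -
  obtain k x where k: "k \<ge> 1" "x \<in> space (Mk k)" "y = Ginf k x"
    using G(2) y unfolding direct_limit_def by metis
  have RR_in: "RR k x \<in> space (Mk' k)"
    using RR[OF k(1)] k(2) by (simp add: module_map_def linear_map_def)
  have Ry: "R y = Ginf' k (RR k x)"
    using R k by simp
  have Ginf_in: "Ginf l z \<in> space M" if "l \<ge> 1" "z \<in> space (Mk l)" for l z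
    using G(2) that unfolding direct_limit_def linear_map_def by simp
  have G_in: "G l k x \<in> space (Mk l)" if "l \<ge> k" for l
    using G(1) k(1,2) that unfolding inductive_system_def linear_map_def by simp
  show "R (act M (E i) y) = act M' (E i) (R y)" if i: "i \<le> rk X"
  \<comment> \<open>Both sides are limits of the images under \<open>R\<close> of the vectors \<open>e\<^sub>i x\<^sub>l\<close>, with \<open>x\<^sub>l\<close> the image
    of \<open>x\<close> at stage \<open>l\<close>.\<close>
  proof (rule vec_lim_unique[OF q])
    let ?s = "\<lambda>l. Ginf l (act (Mk l) (E i) (G l k x))"
    have s: "act (Mk l) (E i) (G l k x) \<in> space (Mk l)" if "l \<ge> k" for l
      using that k(1) i G_in by (intro cl) simp_all
    have "vec_lim q m ?s (act M (E i) y)"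
      using G(3) k i unfolding limit_action_def by simp
    moreover have "\<forall>\<^sub>F l in sequentially. ?s l \<in> space M"
      using eventually_ge_at_top[of k]
      by eventually_elim (use k(1) s Ginf_in in simp)
    ultimately show "vec_lim q m (\<lambda>l. R (?s l)) (R (act M (E i) y))"
      using clM[of "E i" y] i y by (intro vec_lim_linear[OF q _ linR]) simp_all
    have "vec_lim q m (\<lambda>l. Ginf' l (act (Mk' l) (E i) (G' l k (RR k x)))) (act M' (E i) (R y))"
      unfolding Ry using G'(2) k(1) RR_in i unfolding limit_action_def by simp
    moreover have "\<forall>\<^sub>F l in sequentially. Ginf' l (act (Mk' l) (E i) (G' l k (RR k x))) = R (?s l)"
      using eventually_ge_at_top[of k]
    proof eventually_elim
      case (elim l)
      then have l: "l \<ge> 1" using k(1) by simp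
      show ?case
        using R[OF l s[OF elim]] module_map_act[OF RR[OF l], of "E i" "G l k x"] i
          G_in[OF elim] morph[OF k(1) elim k(2)] by simp
    qed
    ultimately show "vec_lim q m (\<lambda>l. R (?s l)) (act M' (E i) (R y))"
      by (rule vec_lim_cong[rotated])
  qed
  show "R (act M (K i) y) = act M' (K i) (R y)" if i: "i \<in> idx X"
  proof -
    have Ki: "K i \<in> letters_b X" using i by (simp add: idx_def)
    let ?z = "act (Mk k) (K i) x"
    have z: "?z \<in> space (Mk k)"
      by (rule cl[OF k(1) Ki k(2)])
    have "R (act M (K i) y) = R (vscale (cu (\<kappa> k i)) (Ginf k ?z))"
      using G(3) k(1,2) i unfolding limit_action_def k(3) by simp
    also have "\<dots> = vscale (cu (\<kappa> k i)) (R (Ginf k ?z))"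
      using linR Ginf_in[OF k(1) z] by (simp add: linear_map_def)
    also have "R (Ginf k ?z) = Ginf' k (act (Mk' k) (K i) (RR k x))"
      unfolding R[OF k(1) z] module_map_act[OF RR[OF k(1)] Ki k(2)] ..
    also have "vscale (cu (\<kappa> k i)) \<dots> = act M' (K i) (R y)"
      using G'(2) k(1) RR_in i unfolding limit_action_def Ry by simp
    finally show ?thesis .
  qed
qed

lemma module_map_subset: "module_map S M N f \<Longrightarrow> S' \<subseteq> S \<Longrightarrow> module_map S' M N f"
  unfolding module_map_def falg_on_def by blast

text \<open>Abstracting from the stable maps to arbitrary transition maps leaves a statement about a
  morphism of inductive systems and its limit.\<close>

lemma affine_R_matrixE:
  assumes "affine_R_matrix X q \<theta> V W R"
  obtains \<Psi> \<Psi>' D D' RR m \<kappa> G G' Ginf Ginf' where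
    "approximates X q \<theta> \<Psi> V D" "approximates X q \<theta> \<Psi>' W D'"
    "\<forall>k\<ge>1. rational_R X (amod D k) (avec D k) (amod D' k) (avec D' k) (RR k)"
    "strict_mono m"
    "inductive_system (\<lambda>k. tensor (spectral uu (amod D k)) (ext_scal (amod D' k))) G"
    "inductive_system (\<lambda>k. tensor (ext_scal (amod D' k)) (spectral uu (amod D k))) G'"
    "direct_limit (\<lambda>k. tensor (spectral uu (amod D k)) (ext_scal (amod D' k))) G
      (tensor (spectral uu V) (ext_scal W)) Ginf"
    "direct_limit (\<lambda>k. tensor (ext_scal (amod D' k)) (spectral uu (amod D k))) G'
      (tensor (ext_scal W) (spectral uu V)) Ginf'"
    "limit_action X q m \<kappa> (\<lambda>k. tensor (spectral uu (amod D k)) (ext_scal (amod D' k))) G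
      (tensor (spectral uu V) (ext_scal W)) Ginf"
    "limit_action X q m \<kappa> (\<lambda>k. tensor (ext_scal (amod D' k)) (spectral uu (amod D k))) G'
      (tensor (ext_scal W) (spectral uu V)) Ginf'"
    "\<forall>k\<ge>1. \<forall>l\<ge>k. \<forall>x\<in>space (tensor (spectral uu (amod D k)) (ext_scal (amod D' k))).
      RR l (G l k x) = G' l k (RR k x)"
    "\<forall>k\<ge>1. \<forall>x\<in>space (tensor (spectral uu (amod D k)) (ext_scal (amod D' k))).
      R (Ginf k x) = Ginf' k (RR k x)"
  using assms unfolding affine_R_matrix_def Let_def
  by (elim conjE exE) (rule that; assumption)

text \<open>All rational \<open>R\<close>-matrices are isomorphisms of modules over the full quantum loop algebra, and
  \<open>R\<close> is their limit. Here \<open>q\<close> must not be a root of unity, for otherwise the powers of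
  \<open>q\<^sup>-\<^sup>1\<close> would take finitely many values and limits would not be unique.\<close>

theorem affine_R_matrix_b_iso:
  assumes q: "q \<noteq> 0" "\<forall>n\<ge>1. q ^ n \<noteq> 1" and a: "aa X 0 = 1"
    and R: "affine_R_matrix X q \<theta> V W R"
  shows "b_iso X (tensor (spectral uu V) (ext_scal W)) (tensor (ext_scal W) (spectral uu V)) R"
proof -
  have bV: "b_module X q V" and bW: "b_module X q W"
    using R by (simp_all only: affine_R_matrix_def in_O_minus_def in_O_def)
  obtain \<Psi> \<Psi>' D D' RR m \<kappa> G G' Ginf Ginf' where
    approx: "approximates X q \<theta> \<Psi> V D" "approximates X q \<theta> \<Psi>' W D'"
    and rat: "\<forall>k\<ge>1. rational_R X (amod D k) (avec D k) (amod D' k) (avec D' k) (RR k)"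
    and m: "strict_mono m"
    and sys0: "inductive_system (\<lambda>k. tensor (spectral uu (amod D k)) (ext_scal (amod D' k))) G"
      "inductive_system (\<lambda>k. tensor (ext_scal (amod D' k)) (spectral uu (amod D k))) G'"
      "direct_limit (\<lambda>k. tensor (spectral uu (amod D k)) (ext_scal (amod D' k))) G
        (tensor (spectral uu V) (ext_scal W)) Ginf"
      "direct_limit (\<lambda>k. tensor (ext_scal (amod D' k)) (spectral uu (amod D k))) G'
        (tensor (ext_scal W) (spectral uu V)) Ginf'"
      "limit_action X q m \<kappa> (\<lambda>k. tensor (spectral uu (amod D k)) (ext_scal (amod D' k))) G
        (tensor (spectral uu V) (ext_scal W)) Ginf"
      "limit_action X q m \<kappa> (\<lambda>k. tensor (ext_scal (amod D' k)) (spectral uu (amod D k))) G'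
        (tensor (ext_scal W) (spectral uu V)) Ginf'"
    and morph0: "\<forall>k\<ge>1. \<forall>l\<ge>k. \<forall>x\<in>space (tensor (spectral uu (amod D k)) (ext_scal (amod D' k))).
      RR l (G l k x) = G' l k (RR k x)"
    and lim0: "\<forall>k\<ge>1. \<forall>x\<in>space (tensor (spectral uu (amod D k)) (ext_scal (amod D' k))).
      R (Ginf k x) = Ginf' k (RR k x)"
    using affine_R_matrixE[OF R] .
  define Mk where "Mk = (\<lambda>k. tensor (spectral uu (amod D k)) (ext_scal (amod D' k)))"
  define Mk' where "Mk' = (\<lambda>k. tensor (ext_scal (amod D' k)) (spectral uu (amod D k)))"
  define M where "M = tensor (spectral uu V) (ext_scal W)"
  define M' where "M' = tensor (ext_scal W) (spectral uu V)"
  note sys = sys0[folded Mk_def Mk'_def M_def M'_def]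
  have Mk: "tensor (spectral uu (amod D k)) (ext_scal (amod D' k)) = Mk k"
    and Mk': "tensor (ext_scal (amod D' k)) (spectral uu (amod D k)) = Mk' k" for k
    by (simp_all only: Mk_def Mk'_def)
  have fd: "b_module X q (amod D k)" "b_module X q (amod D' k)" if "k \<ge> 1" for k
    using approx that unfolding approximates_def fd_simple_def by (blast intro: g_module_imp_b_module)+
  have iso: "g_iso X (Mk k) (Mk' k) (RR k)" if "k \<ge> 1" for k
    using rat that unfolding rational_R_def Mk Mk' by blast
  then have RR: "module_map (letters_b X) (Mk k) (Mk' k) (RR k)" if "k \<ge> 1" for k
    using that unfolding g_iso_def by (blast intro: module_map_subset[OF _ letters_b_subset_g])
  have RR_lin: "linear_map (space (Mk k)) (space (Mk' k)) (RR k)" if "k \<ge> 1" for k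
    using RR[OF that] unfolding module_map_def by blast
  have RR_bij: "bij_betw (RR k) (space (Mk k)) (space (Mk' k))" if "k \<ge> 1" for k
    using iso[OF that] unfolding g_iso_def by blast
  have morph: "RR l (G l k x) = G' l k (RR k x)" if "k \<ge> 1" "l \<ge> k" "x \<in> space (Mk k)" for k l x
    using morph0 that unfolding Mk by blast
  have lim: "R (Ginf k x) = Ginf' k (RR k x)" if "k \<ge> 1" "x \<in> space (Mk k)" for k x
    using lim0 that unfolding Mk by blast
  have lin: "linear_map (space M) (space M') R"
    by (rule direct_limit_iso(1)[OF sys(1,3,2,4)]) (erule RR_lin RR_bij morph lim; assumption)+
  have bij: "bij_betw R (space M) (space M')"
    by (rule direct_limit_iso(2)[OF sys(1,3,2,4)]) (erule RR_lin RR_bij morph lim; assumption)+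
  have cl: "act (Mk k) g x \<in> space (Mk k)"
    if "k \<ge> 1" "g \<in> letters_b X" "x \<in> space (Mk k)" for k g x
    using linear_map_tensor[OF fd(1)[OF that(1)] fd(2)[OF that(1)] that(2), of uu 1] that(3)
    unfolding linear_map_def ext_scal_conv_spectral[symmetric] Mk by blast
  have clM: "act M g x \<in> space M" if "g \<in> letters_b X" "x \<in> space M" for g x
    using linear_map_tensor[OF bV bW that(1), of uu 1] that(2)
    unfolding linear_map_def ext_scal_conv_spectral[symmetric] M_def by blast
  note intertwines = direct_limit_intertwines[OF q m sys(1,3,5,4,6)]
  have E: "R (act M (E i) y) = act M' (E i) (R y)" if "i \<le> rk X" "y \<in> space M" for i y
    by (rule intertwines(1)[where RR = RR, OF _ _ _ _ _ lin that(2,1)])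
      (erule RR cl clM morph lim; assumption)+
  have K: "R (act M (K i) y) = act M' (K i) (R y)" if "i \<in> idx X" "y \<in> space M" for i y
    by (rule intertwines(2)[where RR = RR, OF _ _ _ _ _ lin that(2,1)])
      (erule RR cl clM morph lim; assumption)+
  have "module_map (letters_b X) M M' R"
    using lin E K unfolding M_def M'_def ext_scal_conv_spectral
    by (rule module_map_tensorI[OF a bV bW bW bV])
  with bij show ?thesis
    by (simp only: b_iso_def M_def M'_def)
qed


section \<open>Transport along the functor and the flip\<close>

lemma act_functor_F:
  "act (functor_F M) (E i) v = - act M (Kinv i) (act M (E i) v)"
  "act (functor_F M) (K i) v = act M (Kinv i) v"
  "act (functor_F M) (Kinv i) v = act M (K i) v"
  by (simp_all add: functor_F_def pullback_def)

lemma space_functor_F [simp]: "space (functor_F M) = space M"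
  by (simp add: space_def)

lemma subst_u_inv_powi_deg: "subst_u_inv (s powi gen_deg (E i)) = subst_u_inv s powi gen_deg (E i)"
  by simp

text \<open>The isomorphism \<open>\<sigma>\<close> reverses the coproduct up to the invertible factor \<open>k\<^sub>i\<^sup>-\<^sup>1 \<otimes> k\<^sub>i\<^sup>-\<^sup>1\<close>:
  \<open>(k\<^sub>i\<^sup>-\<^sup>1 \<otimes> k\<^sub>i\<^sup>-\<^sup>1) (e\<^sub>i \<otimes> 1 + k\<^sub>i \<otimes> e\<^sub>i) = k\<^sub>i\<^sup>-\<^sup>1 e\<^sub>i \<otimes> k\<^sub>i\<^sup>-\<^sup>1 + 1 \<otimes> k\<^sub>i\<^sup>-\<^sup>1 e\<^sub>i\<close>, and the flip of the
  right-hand side is minus the image of the coproduct of \<open>e\<^sub>i\<close> under \<open>\<sigma> \<otimes> \<sigma>\<close>. The semilinear flip,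
  which also inverts \<open>u\<close>, therefore carries \<open>P(s) \<otimes> Q(t)\<close> to the tensor product of the pulled back
  modules in the opposite order, with \<open>k\<^sub>i\<close> turned into \<open>k\<^sub>i\<^sup>-\<^sup>1\<close> and \<open>k\<^sub>i\<^sup>-\<^sup>1 e\<^sub>i\<close> into \<open>- e\<^sub>i\<close>.\<close>

lemma flip_transport:
  fixes P :: "('a, complex) qmod" and Q :: "('b, complex) qmod" and s t :: ratfun
  defines "T \<equiv> tensor (spectral s P) (spectral t Q)"
    and "T' \<equiv> tensor (spectral (subst_u_inv t) (functor_F Q)) (spectral (subst_u_inv s) (functor_F P))"
    and "\<Phi> \<equiv> \<lambda>x. subst_vec (flip x)"
  assumes P: "b_module X q P" and Q: "b_module X q Q"
    and P': "b_module X q' (functor_F P)" and Q': "b_module X q' (functor_F Q)"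
    and x: "x \<in> space T" and i: "i \<le> rk X"
  shows "\<Phi> (act T (K i) x) = act T' (Kinv i) (\<Phi> x)"
    and "\<Phi> (act T (Kinv i) x) = act T' (K i) (\<Phi> x)"
    and "\<Phi> (act T (Kinv i) (act T (E i) x)) = - act T' (E i) (\<Phi> x)"
proof -
  have lin: "linear_map (space T) (space T) (act T g)" if "g \<in> letters_b X" for g
    unfolding T_def by (rule linear_map_tensor[OF P Q that])
  have lin': "linear_map (space T') (space T') (act T' g)" if "g \<in> letters_b X" for g
    unfolding T'_def by (rule linear_map_tensor[OF Q' P' that])
  have cl: "act T g y \<in> space T" if "g \<in> letters_b X" "y \<in> space T" for g y
    using lin[OF that(1)] that(2) by (simp add: linear_map_def)
  have add: "act T g (y + z) = act T g y + act T g z"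
    and sc: "act T g (vscale c y) = vscale c (act T g y)"
    if "g \<in> letters_b X" "y \<in> space T" "z \<in> space T" for g y z c
    using lin[OF that(1)] that(2,3) by (simp_all add: linear_map_def)
  have add': "act T' g (y + z) = act T' g y + act T' g z"
    and sc': "act T' g (vscale c y) = vscale c (act T' g y)"
    if "g \<in> letters_b X" "y \<in> space T'" "z \<in> space T'" for g y z c
    using lin'[OF that(1)] that(2,3) by (simp_all add: linear_map_def)
  have \<Phi>_in: "\<Phi> y \<in> space T'" if "y \<in> space T" for y
    using that
    by (simp add: \<Phi>_def T_def T'_def space_def flip_in_vecs_on subst_vec_in_vecs_on)
  have \<Phi>_add: "\<Phi> (y + z) = \<Phi> y + \<Phi> z" and \<Phi>_sc: "\<Phi> (vscale c y) = vscale (subst_u_inv c) (\<Phi> y)" for y z c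
    by (simp_all add: \<Phi>_def flip_simps subst_vec_simps)
  have \<Phi>_pure: "\<Phi> (tens (extend_vec v) (extend_vec w)) = tens (extend_vec w) (extend_vec v)" for v w
    by (simp add: \<Phi>_def flip_simps subst_vec_pure)
  note act_in = act_in_space[OF P] act_in_space[OF Q]
  note act_K = act_tensor_K[OF P Q, where s = s and t = t, folded T_def]
    act_tensor_K[OF Q' P', where s = "subst_u_inv t" and t = "subst_u_inv s", folded T'_def]
  note act_E = act_tensor_E[OF P Q, where s = s and t = t, folded T_def]
    act_tensor_E[OF Q' P', where s = "subst_u_inv t" and t = "subst_u_inv s", folded T'_def]
  have pure_in: "tens (extend_vec v) (extend_vec w) \<in> space T" if "v \<in> space P" "w \<in> space Q" for v w
    unfolding T_def by (rule pure_in_space[OF that])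
  have K: "\<Phi> (act T g x) = act T' g' (\<Phi> x)" if g: "g = K i \<and> g' = Kinv i \<or> g = Kinv i \<and> g' = K i" for g g'
  proof (rule semilinear_tensor_eqI[where \<gamma> = subst_u_inv, OF _ _ _ _ _ x[unfolded T_def], folded T_def])
    have g_b: "g \<in> letters_b X" "g' \<in> letters_b X"
      using g i by auto
    show "\<Phi> (act T g (y + z)) = \<Phi> (act T g y) + \<Phi> (act T g z)"
      "act T' g' (\<Phi> (y + z)) = act T' g' (\<Phi> y) + act T' g' (\<Phi> z)"
      if "y \<in> space T" "z \<in> space T" for y z
      using that g_b by (simp_all add: \<Phi>_add add add' \<Phi>_in)
    show "\<Phi> (act T g (vscale c y)) = vscale (subst_u_inv c) (\<Phi> (act T g y))"
      "act T' g' (\<Phi> (vscale c y)) = vscale (subst_u_inv c) (act T' g' (\<Phi> y))"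
      if "y \<in> space T" for c y
      using sc[OF g_b(1) that that] sc'[OF g_b(2) \<Phi>_in[OF that] \<Phi>_in[OF that]] by (simp_all add: \<Phi>_sc)
    show "\<Phi> (act T g (tens (extend_vec v) (extend_vec w))) =
        act T' g' (\<Phi> (tens (extend_vec v) (extend_vec w)))"
      if "v \<in> space P" "w \<in> space Q" for v w
      using g i that by (auto simp: \<Phi>_pure act_K act_functor_F)
  qed
  then show "\<Phi> (act T (K i) x) = act T' (Kinv i) (\<Phi> x)"
    and "\<Phi> (act T (Kinv i) x) = act T' (K i) (\<Phi> x)"
    by blast+
  have E_b: "E i \<in> letters_b X" "Kinv i \<in> letters_b X"
    using i by simp_all
  show "\<Phi> (act T (Kinv i) (act T (E i) x)) = - act T' (E i) (\<Phi> x)"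
  proof (rule semilinear_tensor_eqI[where \<gamma> = subst_u_inv, OF _ _ _ _ _ x[unfolded T_def], folded T_def])
    show "\<Phi> (act T (Kinv i) (act T (E i) (y + z))) =
        \<Phi> (act T (Kinv i) (act T (E i) y)) + \<Phi> (act T (Kinv i) (act T (E i) z))"
      "- act T' (E i) (\<Phi> (y + z)) = - act T' (E i) (\<Phi> y) + - act T' (E i) (\<Phi> z)"
      if "y \<in> space T" "z \<in> space T" for y z
      using that E_b by (simp_all add: \<Phi>_add add add' \<Phi>_in cl)
    show "\<Phi> (act T (Kinv i) (act T (E i) (vscale c y))) =
        vscale (subst_u_inv c) (\<Phi> (act T (Kinv i) (act T (E i) y)))"
      "- act T' (E i) (\<Phi> (vscale c y)) = vscale (subst_u_inv c) (- act T' (E i) (\<Phi> y))"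
      if "y \<in> space T" for c y
      using sc[OF E_b(1) that that] sc[OF E_b(2) cl[OF E_b(1) that] cl[OF E_b(1) that]]
        sc'[OF E_b(1) \<Phi>_in[OF that] \<Phi>_in[OF that]] by (simp_all add: \<Phi>_sc)
    show "\<Phi> (act T (Kinv i) (act T (E i) (tens (extend_vec v) (extend_vec w)))) =
        - act T' (E i) (\<Phi> (tens (extend_vec v) (extend_vec w)))"
      if v: "v \<in> space P" and w: "w \<in> space Q" for v w
    proof -
      have in_T: "tens (extend_vec (act P (E i) v)) (extend_vec w) \<in> space T"
        "tens (extend_vec (act P (K i) v)) (extend_vec (act Q (E i) w)) \<in> space T"
        using v w i by (intro pure_in act_in; simp)+
      let ?s = "s powi gen_deg (E i)" and ?t = "t powi gen_deg (E i)"
      have "act T (Kinv i) (act T (E i) (tens (extend_vec v) (extend_vec w))) =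
          act T (Kinv i) (vscale ?s (tens (extend_vec (act P (E i) v)) (extend_vec w)) +
            vscale ?t (tens (extend_vec (act P (K i) v)) (extend_vec (act Q (E i) w))))"
        by (simp only: act_E i v w)
      also have "\<dots> =
          vscale ?s (act T (Kinv i) (tens (extend_vec (act P (E i) v)) (extend_vec w))) +
          vscale ?t (act T (Kinv i) (tens (extend_vec (act P (K i) v)) (extend_vec (act Q (E i) w))))"
        using in_T E_b(2) by (simp only: add sc space_closed)
      also have "\<dots> =
          vscale ?s (tens (extend_vec (act P (Kinv i) (act P (E i) v))) (extend_vec (act Q (Kinv i) w))) +
          vscale ?t (tens (extend_vec v) (extend_vec (act Q (Kinv i) (act Q (E i) w))))"
        using v w i by (simp add: act_K act_in K_Kinv[OF P] del: gen_deg.simps)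
      finally have "\<Phi> (act T (Kinv i) (act T (E i) (tens (extend_vec v) (extend_vec w)))) =
          vscale (subst_u_inv ?s)
            (tens (extend_vec (act Q (Kinv i) w)) (extend_vec (act P (Kinv i) (act P (E i) v)))) +
          vscale (subst_u_inv ?t)
            (tens (extend_vec (act Q (Kinv i) (act Q (E i) w))) (extend_vec v))"
        by (simp only: \<Phi>_add \<Phi>_sc \<Phi>_pure)
      also have "\<dots> = - act T' (E i) (\<Phi> (tens (extend_vec v) (extend_vec w)))"
        using v w i
        by (simp add: \<Phi>_pure act_E act_functor_F tens_simps subst_u_inv_powi_deg del: gen_deg.simps)
      finally show ?thesis .
    qed
  qed
qed

text \<open>Conjugating a morphism between the pulled back modules by these semilinear flips gives a morphism
  between the original ones, in the opposite order of factors.\<close>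

lemma b_iso_flip_at_u_inv:
  fixes P :: "('a, complex) qmod" and Q :: "('b, complex) qmod" and s t :: ratfun
  assumes P: "b_module X q P" and Q: "b_module X q Q"
    and P': "b_module X q' (functor_F P)" and Q': "b_module X q' (functor_F Q)"
    and R': "b_iso X
      (tensor (spectral (subst_u_inv t) (functor_F Q)) (spectral (subst_u_inv s) (functor_F P)))
      (tensor (spectral (subst_u_inv s) (functor_F P)) (spectral (subst_u_inv t) (functor_F Q))) R'"
  shows "b_iso X (tensor (spectral s P) (spectral t Q)) (tensor (spectral t Q) (spectral s P))
    (flip \<circ> at_u_inv R' \<circ> flip)"
proof -
  let ?R = "flip \<circ> at_u_inv R' \<circ> flip"
  define A B where "A = tensor (spectral s P) (spectral t Q)"
    and "B = tensor (spectral t Q) (spectral s P)"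
  define A' B' where
    "A' = tensor (spectral (subst_u_inv t) (functor_F Q)) (spectral (subst_u_inv s) (functor_F P))"
    and "B' = tensor (spectral (subst_u_inv s) (functor_F P)) (spectral (subst_u_inv t) (functor_F Q))"
  \<comment> \<open>The semilinear flips are mutually inverse, and the map in question is \<open>\<Phi> R' \<Phi>\<close>.\<close>
  define \<Phi> :: "('a \<times> 'b \<Rightarrow>\<^sub>0 ratfun) \<Rightarrow> ('b \<times> 'a \<Rightarrow>\<^sub>0 ratfun)" where "\<Phi> = (\<lambda>x. subst_vec (flip x))"
  define \<Phi>' :: "('b \<times> 'a \<Rightarrow>\<^sub>0 ratfun) \<Rightarrow> ('a \<times> 'b \<Rightarrow>\<^sub>0 ratfun)" where "\<Phi>' = (\<lambda>x. subst_vec (flip x))"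
  have R'_map: "module_map (letters_b X) A' B' R'" and R'_bij: "bij_betw R' (space A') (space B')"
    using R' by (simp_all add: b_iso_def A'_def B'_def)
  have R'_lin: "linear_map (space A') (space B') R'"
    using R'_map by (simp add: module_map_def)
  have \<Phi>_in: "\<Phi> x \<in> space A'" if "x \<in> space A" for x
    using that by (simp add: \<Phi>_def A_def A'_def space_def flip_in_vecs_on subst_vec_in_vecs_on)
  have \<Phi>'\<Phi>: "\<Phi>' (\<Phi> x) = x" "\<Phi> (\<Phi>' y) = y" for x y
    by (simp_all add: \<Phi>_def \<Phi>'_def subst_vec_flip flip_simps subst_vec_simps)
  have R_eq: "?R x = \<Phi> (R' (\<Phi> x))" for x
    by (simp add: \<Phi>_def at_u_inv_def subst_vec_flip)
  have \<Phi>_in_B: "\<Phi> y \<in> space B" if "y \<in> space B'" for y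
    using that by (simp add: \<Phi>_def B_def B'_def space_def flip_in_vecs_on subst_vec_in_vecs_on)
  have \<Phi>'_in: "\<Phi>' y \<in> space B'" if "y \<in> space B" for y
    using that by (simp add: \<Phi>'_def B_def B'_def space_def flip_in_vecs_on subst_vec_in_vecs_on)
  have \<Phi>'_in_A: "\<Phi>' y \<in> space A" if "y \<in> space A'" for y
    using that by (simp add: \<Phi>'_def A_def A'_def space_def flip_in_vecs_on subst_vec_in_vecs_on)
  have R'_in: "R' x \<in> space B'" if "x \<in> space A'" for x
    using R'_lin that by (simp add: linear_map_def)
  have R_in: "?R x \<in> space B" if "x \<in> space A" for x
    unfolding R_eq by (intro \<Phi>_in_B R'_in \<Phi>_in that)
  have R_lin: "linear_map (space A) (space B) ?R"
    unfolding linear_map_def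
  proof (intro conjI ballI allI)
    fix x y c assume x: "x \<in> space A" and y: "y \<in> space A"
    have "R' (\<Phi> x + \<Phi> y) = R' (\<Phi> x) + R' (\<Phi> y)"
      using R'_lin \<Phi>_in[OF x] \<Phi>_in[OF y] by (simp add: linear_map_def)
    then show "?R (x + y) = ?R x + ?R y"
      unfolding R_eq by (simp add: \<Phi>_def flip_simps subst_vec_simps)
  next
    fix x c assume x: "x \<in> space A"
    have "R' (vscale (subst_u_inv c) (\<Phi> x)) = vscale (subst_u_inv c) (R' (\<Phi> x))"
      using R'_lin \<Phi>_in[OF x] by (simp add: linear_map_def)
    then show "?R (vscale c x) = vscale c (?R x)"
      unfolding R_eq by (simp add: \<Phi>_def flip_simps subst_vec_simps)
  qed (rule R_in)
  have "bij_betw \<Phi> (space A) (space A')"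
    by (rule bij_betw_byWitness[where f' = \<Phi>']) (use \<Phi>_in \<Phi>'_in_A \<Phi>'\<Phi> in auto)
  moreover have "bij_betw \<Phi> (space B') (space B)"
    by (rule bij_betw_byWitness[where f' = \<Phi>']) (use \<Phi>_in_B \<Phi>'_in \<Phi>'\<Phi> in auto)
  ultimately have "bij_betw (\<Phi> \<circ> (R' \<circ> \<Phi>)) (space A) (space B)"
    using R'_bij by (intro bij_betw_trans)
  moreover have "\<Phi> \<circ> (R' \<circ> \<Phi>) = ?R"
    using R_eq by (simp add: fun_eq_iff)
  ultimately have R_bij: "bij_betw ?R (space A) (space B)"
    by simp

  have \<Phi>_app: "\<Phi> x = subst_vec (flip x)" and \<Phi>'_app: "\<Phi>' y = subst_vec (flip y)" for x y
    by (simp_all add: \<Phi>_def \<Phi>'_def)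
  note trA = flip_transport[OF P Q P' Q', where s = s and t = t,
      folded A_def A'_def, folded \<Phi>_app]
    and trB = flip_transport[OF Q P Q' P', where s = t and t = s,
      folded B_def B'_def, folded \<Phi>'_app]
  have \<Phi>'R: "\<Phi>' (?R x) = R' (\<Phi> x)" for x
    unfolding R_eq by (rule \<Phi>'\<Phi>(1)) 
  have inj: "x = y" if "\<Phi>' x = \<Phi>' y" for x y
    using arg_cong[OF that, of \<Phi>] by (simp only: \<Phi>'\<Phi>)
  have cl: "act A g x \<in> space A" if "g \<in> letters_b X" "x \<in> space A" for g x
    using linear_map_tensor[OF P Q that(1), of s t] that(2) by (simp add: linear_map_def A_def)
  have clB: "act B g x \<in> space B" if "g \<in> letters_b X" "x \<in> space B" for g x
    using linear_map_tensor[OF Q P that(1), of t s] that(2) by (simp add: linear_map_def B_def)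
  note R'_act = module_map_act[OF R'_map _ \<Phi>_in]
  have K: "?R (act A (K i) x) = act B (K i) (?R x)"
    and Kinv: "?R (act A (Kinv i) x) = act B (Kinv i) (?R x)"
    if i: "i \<le> rk X" and x: "x \<in> space A" for i x
    by (rule inj, simp only: \<Phi>'R trA[OF x i] trB[OF R_in[OF x] i] R'_act letters_b_mem i x)+
  have E: "?R (act A (E i) x) = act B (E i) (?R x)"
    if i: "i \<le> rk X" and x: "x \<in> space A" for i x
  proof -
    have i_b: "E i \<in> letters_b X" "Kinv i \<in> letters_b X"
      using i by simp_all
    have "\<Phi>' (?R (act A (Kinv i) (act A (E i) x))) = - R' (act A' (E i) (\<Phi> x))"
      unfolding \<Phi>'R trA(3)[OF x i]
      using linear_map_tensor[OF Q' P' i_b(1), of "subst_u_inv t" "subst_u_inv s"] \<Phi>_in[OF x]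
      by (intro linear_map_uminus[OF R'_lin]) (simp add: linear_map_def A'_def)
    also have "\<dots> = \<Phi>' (act B (Kinv i) (act B (E i) (?R x)))"
      unfolding trB(3)[OF R_in[OF x] i] \<Phi>'R R'_act[OF i_b(1) x] ..
    finally have "?R (act A (Kinv i) (act A (E i) x)) = act B (Kinv i) (act B (E i) (?R x))"
      by (rule inj)
    \<comment> \<open>Cancel \<open>k\<^sub>i\<^sup>-\<^sup>1\<close>, with which the map is already known to commute.\<close>
    then have "act B (Kinv i) (?R (act A (E i) x)) = act B (Kinv i) (act B (E i) (?R x))"
      unfolding Kinv[OF i cl[OF i_b(1) x]] .
    then have "act B (K i) (act B (Kinv i) (?R (act A (E i) x))) =
        act B (K i) (act B (Kinv i) (act B (E i) (?R x)))"
      by (rule arg_cong)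
    then show ?thesis
      unfolding K_Kinv_tensor(1)[OF Q P i, of _ t s, folded B_def, OF R_in[OF cl[OF i_b(1) x]]]
        K_Kinv_tensor(1)[OF Q P i, of _ t s, folded B_def, OF clB[OF i_b(1) R_in[OF x]]] .
  qed
  have "module_map (letters_b X) A B ?R"
  proof (rule module_mapI[OF R_lin cl])
    show "?R (act A g x) = act B g (?R x)" if "g \<in> letters_b X" "x \<in> space A" for g x
      using that(1) E[OF _ that(2)] K[OF _ that(2)] Kinv[OF _ that(2)]
      by (cases g) (simp_all only: letters_b_mem)
  qed
  with R_bij show ?thesis
    by (simp add: b_iso_def A_def B_def)
qed


section \<open>Shifting both spectral parameters\<close>

text \<open>Multiplying both spectral parameters by \<open>c\<close> is the pullback by \<open>\<tau>\<^sub>c\<close>: it rescales the operator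
  of a generator of degree \<open>d\<close> by \<open>c\<^sup>d\<close>.\<close>

lemma act_tensor_shift:
  assumes P: "b_module X q P" and Q: "b_module X q Q" and g: "g \<in> letters_b X"
    and x: "x \<in> space (tensor (spectral s P) (spectral t Q))"
  shows "act (tensor (spectral (c * s) P) (spectral (c * t) Q)) g x =
    vscale (c powi gen_deg g) (act (tensor (spectral s P) (spectral t Q)) g x)"
proof -
  let ?T = "tensor (spectral s P) (spectral t Q)"
    and ?T' = "tensor (spectral (c * s) P) (spectral (c * t) Q)"
  have sp: "space ?T' = space ?T"
    by (simp add: space_def)
  have lin: "linear_map (space ?T) (space ?T) (\<lambda>x. vscale (c powi gen_deg g) (act ?T g x))"
    using linear_map_tensor[OF P Q g, of s t]
    by (simp add: linear_map_def vscale_add mult.commute)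
  have lin': "linear_map (space ?T) (space ?T) (act ?T' g)"
    using linear_map_tensor[OF P Q g, of "c * s" "c * t"] by (simp only: sp)
  show ?thesis
  proof (rule linear_tensor_eqI[OF lin' lin _ x])
    fix v w assume vw: "v \<in> space P" "w \<in> space Q"
    show "act ?T' g (tens (extend_vec v) (extend_vec w)) =
        vscale (c powi gen_deg g) (act ?T g (tens (extend_vec v) (extend_vec w)))"
      using vw g
      by (cases g)
        (auto simp: act_tensor_E[OF P Q] act_tensor_K[OF P Q] vscale_add power_int_mult_distrib)
  qed
qed

lemma b_iso_shift:
  assumes P: "b_module X q P" "b_module X q Q" and P': "b_module X q' P'" "b_module X q' Q'"
    and f: "b_iso X (tensor (spectral s P) (spectral t Q)) (tensor (spectral s' P') (spectral t' Q')) f"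
  shows "b_iso X (tensor (spectral (c * s) P) (spectral (c * t) Q))
    (tensor (spectral (c * s') P') (spectral (c * t') Q')) f"
proof -
  let ?T = "tensor (spectral s P) (spectral t Q)"
    and ?T' = "tensor (spectral s' P') (spectral t' Q')"
    and ?S = "tensor (spectral (c * s) P) (spectral (c * t) Q)"
    and ?S' = "tensor (spectral (c * s') P') (spectral (c * t') Q')"
  have sp: "space ?S = space ?T" "space ?S' = space ?T'"
    by (simp_all add: space_def)
  have map: "module_map (letters_b X) ?T ?T' f" and bij: "bij_betw f (space ?T) (space ?T')"
    using f by (simp_all add: b_iso_def)
  have lin: "linear_map (space ?T) (space ?T') f"
    using map by (simp add: module_map_def)
  have cl: "act ?T g x \<in> space ?T" if "g \<in> letters_b X" "x \<in> space ?T" for g x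
    using linear_map_tensor[OF P that(1), of s t] that(2) by (simp add: linear_map_def)
  have "module_map (letters_b X) ?S ?S' f"
  proof (rule module_mapI)
    show "linear_map (space ?S) (space ?S') f"
      unfolding sp by (rule lin)
    fix g x assume g: "g \<in> letters_b X" and x: "x \<in> space ?S"
    then have x': "x \<in> space ?T" and fx: "f x \<in> space ?T'"
      using lin by (simp_all add: sp linear_map_def)
    show "act ?S g x \<in> space ?S"
      unfolding act_tensor_shift[OF P g x'] sp by (intro space_closed cl g x')
    have "f (act ?S g x) = vscale (c powi gen_deg g) (f (act ?T g x))"
      unfolding act_tensor_shift[OF P g x'] using lin cl[OF g x'] by (simp add: linear_map_def)
    also have "\<dots> = act ?S' g (f x)"
      unfolding act_tensor_shift[OF P' g fx] module_map_act[OF map g x'] ..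
    finally show "f (act ?S g x) = act ?S' g (f x)" .
  qed
  with bij show ?thesis
    by (simp only: b_iso_def sp)
qed

text \<open>The flip formula gives \<open>V \<otimes> W(u\<^sup>-\<^sup>1)\<close>, and shifting the parameters \<open>(1, u\<^sup>-\<^sup>1)\<close> by \<open>u\<close> turns
  them into \<open>(u, 1)\<close>, which is \<open>V(u) \<otimes> W\<close>.\<close>

theorem theorem4p6:
  fixes X :: cartan and h q :: complex
    and \<theta> \<theta>' :: "dgen \<Rightarrow> (gen, complex) falg"
    and V :: "('a, complex) qmod" and W :: "('b, complex) qmod"
    and R' :: "('b \<times> 'a \<Rightarrow>\<^sub>0 ratfun) \<Rightarrow> ('a \<times> 'b \<Rightarrow>\<^sub>0 ratfun)"
    and R :: "('a \<times> 'b \<Rightarrow>\<^sub>0 ratfun) \<Rightarrow> ('b \<times> 'a \<Rightarrow>\<^sub>0 ratfun)"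
  assumes "untwisted_affine X"
    and "q = exp h" and "\<forall>m\<ge>1. q ^ m \<noteq> 1"
    and "drinfeld_correspondence X q \<theta>"
    and "drinfeld_correspondence X (inverse q) \<theta>'"
    and "in_O_plus X q \<theta> V" and "simple_module X V"
    and "in_O_plus X q \<theta> W" and "simple_module X W"
    and "affine_R_matrix X (inverse q) \<theta>' (functor_F W) (functor_F V) R'"
    and "R = flip \<circ> at_u_inv R' \<circ> flip"
  shows "b_iso X (tensor (ext_scal V) (spectral (inverse uu) W)) (tensor (spectral (inverse uu) W) (ext_scal V)) R \<and>
    b_iso X (tensor (spectral uu V) (ext_scal W)) (tensor (ext_scal W) (spectral uu V)) R"
proof -
  have V: "b_module X q V" and W: "b_module X q W"
    using assms(6,8) by (simp_all add: in_O_plus_def in_O_def)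
  have FV: "b_module X (inverse q) (functor_F V)" and FW: "b_module X (inverse q) (functor_F W)"
    using assms(10) unfolding affine_R_matrix_def in_O_minus_def in_O_def by simp_all
  have q: "inverse q \<noteq> 0" "\<forall>n\<ge>1. inverse q ^ n \<noteq> 1"
    using assms(2,3) by (simp_all add: power_inverse)
  have a: "aa X 0 = 1"
    using assms(1) by (simp add: untwisted_affine_def)
  have "b_iso X (tensor (spectral uu (functor_F W)) (ext_scal (functor_F V)))
      (tensor (ext_scal (functor_F V)) (spectral uu (functor_F W))) R'"
    by (rule affine_R_matrix_b_iso[OF q a assms(10)])
  then have R: "b_iso X (tensor (spectral 1 V) (spectral (inverse uu) W))
      (tensor (spectral (inverse uu) W) (spectral 1 V)) R"
    unfolding assms(11) ext_scal_conv_spectral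
    by (intro b_iso_flip_at_u_inv[OF V W FV FW]) (simp add: subst_u_inv_inverse)
  from b_iso_shift[OF V W W V this, of uu]
  have "b_iso X (tensor (spectral uu V) (spectral 1 W)) (tensor (spectral 1 W) (spectral uu V)) R"
    by simp
  with R show ?thesis
    by (simp only: ext_scal_conv_spectral)
qed

end
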